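(* Let $n \ge 3$ be an integer, let $p$ be a real number with $1 < p \le \frac{n+2}{n-2}$, and let $q = \frac{2p}{p+1}$. Then there exists $M_1 \in (0, \infty]$ (depending on $n$ and $p$) such that, for every real $M$ with $0 < M < M_1$, every nonnegative solution $v$ on $\mathbb{R}^n$ of $$\Delta v + v^p + M|\nabla v|^q = 0 \quad \text{in } \mathbb{R}^n$$ satisfies $v \equiv 0$. Moreover, if $3 \le n \le 6$, this holds with $M_1 = \infty$, i.e. for every $M > 0$.
   Context: A solution is a global classical solution: a function $v \in C^2(\mathbb{R}^n)$ satisfying the equation at every point of $\mathbb{R}^n$. Nonnegative means $v(x) \ge 0$ for all $x$. No condition on the behaviour of $v$ at infinity is imposed. *)

theory Defs
  imports "HOL-Analysis.Analysis"
begin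

definition has_partial :: "'n::finite \<Rightarrow> (real ^ 'n \<Rightarrow> real) \<Rightarrow> real ^ 'n \<Rightarrow> bool" where
  "has_partial i f x \<longleftrightarrow> (\<lambda>t. f (x + t *\<^sub>R axis i 1)) differentiable (at 0)"

definition partial :: "'n::finite \<Rightarrow> (real ^ 'n \<Rightarrow> real) \<Rightarrow> real ^ 'n \<Rightarrow> real" where
  "partial i f x = deriv (\<lambda>t. f (x + t *\<^sub>R axis i 1)) 0"

definition C1_on_UNIV :: "(real ^ 'n::finite \<Rightarrow> real) \<Rightarrow> bool" where
  "C1_on_UNIV f \<longleftrightarrow>
     (\<forall>i x. has_partial i f x) \<and> (\<forall>i. continuous_on UNIV (partial i f))"

definition C2_on_UNIV :: "(real ^ 'n::finite \<Rightarrow> real) \<Rightarrow> bool" where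
  "C2_on_UNIV f \<longleftrightarrow> C1_on_UNIV f \<and> (\<forall>i. C1_on_UNIV (partial i f))"

definition gradient :: "(real ^ 'n::finite \<Rightarrow> real) \<Rightarrow> real ^ 'n \<Rightarrow> real ^ 'n" where
  "gradient f x = (\<chi> i. partial i f x)"

definition laplacian :: "(real ^ 'n::finite \<Rightarrow> real) \<Rightarrow> real ^ 'n \<Rightarrow> real" where
  "laplacian f x = (\<Sum>i\<in>UNIV. partial i (partial i f) x)"

text \<open>
  No condition at infinity is imposed. The real powers \<open>powr\<close> agree with the usual ones
  for \<open>v \<ge> 0\<close> and positive exponents, where \<open>0 powr p = 0\<close>.
\<close>
definition nonneg_solution ::
    "real \<Rightarrow> real \<Rightarrow> real \<Rightarrow> (real ^ 'n::finite \<Rightarrow> real) \<Rightarrow> bool" where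
  "nonneg_solution p q M v \<longleftrightarrow>
     C2_on_UNIV v \<and> (\<forall>x. v x \<ge> 0) \<and>
     (\<forall>x. laplacian v x + v x powr p + M * norm (gradient v x) powr q = 0)"

end

theory Submission
  imports Defs
begin

text \<open>A nonnegative solution \<open>v\<close> is superharmonic. Comparison with the harmonic function
\<open>|x|\<^sup>2\<^sup>-\<^sup>n\<close> on large annuli shows that either \<open>v\<close> vanishes identically or
\<open>v(x) \<ge> k (1 + |x|)\<^sup>2\<^sup>-\<^sup>n\<close> with \<open>k > 0\<close> (\<open>superharmonic_lower_bound\<close>); so assume the latter.

The heart is a Bochner--Obata computation. With \<open>\<alpha> = -2/(n-2)\<close> let \<open>E\<close> be the trace-free part of
\<open>D\<^sup>2v - n/(n-2) \<nabla>v \<otimes> \<nabla>v / v\<close>, the tensor that vanishes on the positive entire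
solutions of the Yamabe equation. The divergence of
\<open>v\<^sup>\<alpha> E \<nabla>v - s (n-1)/n M v\<^sup>\<alpha> |\<nabla>v|\<^sup>q \<nabla>v\<close> equals \<open>v\<^sup>\<alpha>\<close> times a sum of
\<open>|E|\<^sup>2\<close>, a positive multiple of \<open>((n+2)/(n-2) - p) v\<^sup>p\<^sup>-\<^sup>1 |\<nabla>v|\<^sup>2\<close>, the products of
\<open>M |\<nabla>v|\<^sup>q\<close> with multiples of \<open>|\<nabla>v|\<^sup>2/v\<close>, \<open>v\<^sup>p\<close> and \<open>M |\<nabla>v|\<^sup>q\<close>, and one indefinite cross term linear in \<open>E(\<nabla>v,\<nabla>v)\<close> (\<open>obata_identity\<close>). The cross term is absorbed by
Cauchy--Schwarz, which costs a multiple of \<open>M\<^sup>2 |\<nabla>v|\<^sup>2\<^sup>q\<close>. Two things can pay for this. For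
small \<open>M\<close>, the choice \<open>q = 2p/(p+1)\<close> gives \<open>|\<nabla>v|\<^sup>q \<le> |\<nabla>v|\<^sup>2/v + v\<^sup>p\<close>, and
the good terms control \<open>M |\<nabla>v|\<^sup>q\<close> times the right-hand side (\<open>coercive_small_M\<close>). For
arbitrary \<open>M\<close> one needs the good \<open>M\<^sup>2 |\<nabla>v|\<^sup>2\<^sup>q\<close> term itself to win; with \<open>s = 1/4\<close> it does so
for \<open>n \<le> 6\<close> (\<open>coercive_low_dimension\<close>). Either way the divergence is at least
\<open>c v\<^sup>\<alpha> P\<close> with \<open>P = |E|\<^sup>2 + |\<nabla>v|\<^sup>2\<^sup>q\<close> and \<open>c > 0\<close>.

Integrating against a cut-off function \<open>\<psi>\<close> of scale \<open>R\<close> gives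
\<open>c \<integral> v\<^sup>\<alpha> P \<psi> \<le> C \<integral> v\<^sup>\<alpha> P\<^sup>\<theta> |\<nabla>\<psi>|\<close> with \<open>\<theta> = 1/2 + 1/(2q)\<close>. Young's inequality
turns the right-hand side into a multiple of \<open>\<integral> v\<^sup>\<alpha> P \<psi>\<close> plus
\<open>R\<close> to the power \<open>-1/(1-\<theta>) = -4p/(p-1)\<close> times \<open>\<integral>\<^sub>|\<^sub>x\<^sub>|\<^sub>\<le>\<^sub>R v\<^sup>\<alpha>\<close>. The lower bound on \<open>v\<close> gives
\<open>v\<^sup>\<alpha> \<le> C (1 + |x|)\<^sup>2\<close>, so the remainder is of order \<open>R\<close> to the power
\<open>n + 2 - 4p/(p-1)\<close>, which is bounded exactly because \<open>p \<le> (n+2)/(n-2)\<close>. Hence \<open>v\<^sup>\<alpha> P\<close> is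
integrable; since \<open>|\<nabla>\<psi>|\<close> carries a factor \<open>|x|/R\<close>, the error then tends to zero even at the
critical exponent (\<open>absorb_in_the_limit\<close>). So \<open>P = 0\<close>, \<open>\<nabla>v = 0\<close>, and the equation yields \<open>v\<^sup>p = 0\<close>, a
contradiction.

A solution is only twice continuously differentiable, while Bochner's formula involves third
derivatives. But \<open>\<Delta>v = -v\<^sup>p - M |\<nabla>v|\<^sup>q\<close> is continuously differentiable since \<open>q > 1\<close>, and
with that alone the formula holds weakly: apply the divergence theorem to difference quotients of
\<open>\<nabla>v\<close> and pass to the limit (\<open>weak_bochner\<close>).\<close>

section \<open>Partial derivatives along the coordinate axes\<close>

text \<open>A relational form of the partial derivative, so that derivatives of composite expressions can be
derived by rules that carry the value along.\<close>

definition has_pd :: "'n::finite \<Rightarrow> (real ^ 'n \<Rightarrow> real) \<Rightarrow> real ^ 'n \<Rightarrow> real \<Rightarrow> bool" where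
  "has_pd i f x d \<longleftrightarrow> ((\<lambda>t. f (x + t *\<^sub>R axis i 1)) has_real_derivative d) (at 0)"

lemma has_pd_const: "has_pd i (\<lambda>_. c) x 0"
  by (simp add: has_pd_def)

lemma has_pd_add:
  assumes "has_pd i f x a" "has_pd i g x b"
  shows "has_pd i (\<lambda>x. f x + g x) x (a + b)"
  using assms unfolding has_pd_def by (rule DERIV_add)

lemma has_pd_diff:
  assumes "has_pd i f x a" "has_pd i g x b"
  shows "has_pd i (\<lambda>x. f x - g x) x (a - b)"
  using assms unfolding has_pd_def by (rule DERIV_diff)

lemma has_pd_mult:
  assumes "has_pd i f x a" "has_pd i g x b"
  shows "has_pd i (\<lambda>x. f x * g x) x (a * g x + f x * b)"
  using DERIV_mult[OF assms[unfolded has_pd_def]]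
  unfolding has_pd_def by (simp add: algebra_simps)

lemma has_pd_cmult:
  assumes "has_pd i f x a"
  shows "has_pd i (\<lambda>x. c * f x) x (c * a)"
  using assms unfolding has_pd_def by (rule DERIV_cmult)

lemma has_pd_sum:
  assumes "\<And>j. j \<in> S \<Longrightarrow> has_pd i (f j) x (a j)"
  shows "has_pd i (\<lambda>x. \<Sum>j\<in>S. f j x) x (\<Sum>j\<in>S. a j)"
  using assms unfolding has_pd_def by (intro DERIV_sum)

lemma has_pd_chain:
  assumes "(\<phi> has_real_derivative d) (at (f x))" "has_pd i f x a"
  shows "has_pd i (\<lambda>x. \<phi> (f x)) x (d * a)"
  using DERIV_chain2[of \<phi> d "\<lambda>t. f (x + t *\<^sub>R axis i 1)" 0 a UNIV] assms
  by (simp add: has_pd_def)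

lemma has_pd_nth: "has_pd i (\<lambda>x. x $ j) x (if j = i then 1 else 0)"
proof -
  have "((\<lambda>t. x $ j + t * axis i 1 $ j) has_real_derivative axis i 1 $ j) (at 0)"
    by (auto intro!: derivative_eq_intros)
  moreover have "axis i 1 $ j = (if j = i then 1 else 0 :: real)"
    by (simp add: axis_def)
  ultimately show ?thesis
    by (simp add: has_pd_def)
qed

lemma has_pd_shift:
  assumes "has_pd i f (x + c) d"
  shows "has_pd i (\<lambda>x. f (x + c)) x d"
  using assms by (simp add: has_pd_def algebra_simps)

lemma has_pd_unique: "has_pd i f x a \<Longrightarrow> has_pd i f x b \<Longrightarrow> a = b"
  unfolding has_pd_def by (rule DERIV_unique)

lemma has_pd_at_point_of_line:
  assumes "has_pd i f (x + s *\<^sub>R axis i 1) d"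
  shows "((\<lambda>t. f (x + t *\<^sub>R axis i 1)) has_real_derivative d) (at s)"
proof -
  have "((\<lambda>t. f (x + (t + s) *\<^sub>R axis i 1)) has_real_derivative d) (at 0)"
    using assms by (simp add: has_pd_def algebra_simps)
  then show ?thesis
    using DERIV_shift[of "\<lambda>t. f (x + t *\<^sub>R axis i 1)" _ 0 s] by simp
qed

lemma pd_mean_value:
  assumes "\<And>x. has_pd i f x (f' x)"
  shows "\<exists>z. \<bar>z\<bar> \<le> \<bar>h\<bar> \<and> f (x + h *\<^sub>R axis i 1) - f x = h * f' (x + z *\<^sub>R axis i 1)"
proof -
  let ?g = "\<lambda>t. f (x + t *\<^sub>R axis i 1)" and ?g' = "\<lambda>t. f' (x + t *\<^sub>R axis i 1)"
  have d: "(?g has_real_derivative ?g' t) (at t)" for t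
    by (rule has_pd_at_point_of_line) (rule assms)
  consider "h = 0" | "h > 0" | "h < 0" by linarith
  then show ?thesis
  proof cases
    case 1
    then show ?thesis by (intro exI[of _ 0]) auto
  next
    case 2
    then obtain z where "0 < z" "z < h" "?g h - ?g 0 = (h - 0) * ?g' z"
      using MVT2[of 0 h ?g ?g'] d by auto
    then show ?thesis by (intro exI[of _ z]) auto
  next
    case 3
    then obtain z where "h < z" "z < 0" "?g 0 - ?g h = (0 - h) * ?g' z"
      using MVT2[of h 0 ?g ?g'] d by auto
    then show ?thesis by (intro exI[of _ z]) auto
  qed
qed

text \<open>Changing one coordinate at a time turns bounds on the partial derivatives into a bound on
  increments; this is what makes functions with continuous partial derivatives continuous.\<close>

lemma increment_le_pd_bound:
  fixes u :: "real ^ 'n::finite \<Rightarrow> real"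
  assumes pd: "\<And>i x. has_pd i u x (u' i x)"
    and bound: "\<And>i y. dist y x \<le> \<delta> \<Longrightarrow> \<bar>u' i y\<bar> \<le> B"
    and h: "norm h \<le> \<delta>"
  shows "\<bar>u (x + h) - u x\<bar> \<le> B * (\<Sum>i\<in>UNIV. \<bar>h $ i\<bar>)"
proof -
  define hS where "hS = (\<lambda>S. (\<chi> i. if i \<in> S then h $ i else 0) :: real ^ 'n)"
  have "finite S \<Longrightarrow> \<bar>u (x + hS S) - u x\<bar> \<le> B * (\<Sum>i\<in>S. \<bar>h $ i\<bar>)" for S
  proof (induction S rule: finite_induct)
    case empty
    have "hS {} = 0" by (simp add: hS_def vec_eq_iff)
    then show ?case by simp
  next
    case (insert j S)
    have split: "hS (insert j S) = hS S + (h $ j) *\<^sub>R axis j 1"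
      using insert.hyps by (auto simp: hS_def vec_eq_iff axis_def)
    obtain z where z: "\<bar>z\<bar> \<le> \<bar>h $ j\<bar>"
      "u (x + hS S + (h $ j) *\<^sub>R axis j 1) - u (x + hS S) = h $ j * u' j (x + hS S + z *\<^sub>R axis j 1)"
      using pd_mean_value[of j u "u' j" "h $ j" "x + hS S"] pd by blast
    have "norm (hS S + z *\<^sub>R axis j 1) \<le> norm h"
      by (rule norm_le_componentwise_cart) (use z insert.hyps in \<open>auto simp: hS_def axis_def\<close>)
    then have "\<bar>u' j (x + hS S + z *\<^sub>R axis j 1)\<bar> \<le> B"
      using h by (intro bound) (simp add: dist_norm algebra_simps)
    then have "\<bar>h $ j * u' j (x + hS S + z *\<^sub>R axis j 1)\<bar> \<le> \<bar>h $ j\<bar> * B"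
      by (simp add: abs_mult mult_left_mono)
    then have "\<bar>u (x + hS (insert j S)) - u (x + hS S)\<bar> \<le> B * \<bar>h $ j\<bar>"
      using z by (simp add: split algebra_simps)
    then show ?case
      using insert by (simp add: algebra_simps)
  qed
  from this[of UNIV] have "\<bar>u (x + hS UNIV) - u x\<bar> \<le> B * (\<Sum>i\<in>UNIV. \<bar>h $ i\<bar>)"
    by simp
  moreover have "hS UNIV = h" by (simp add: hS_def vec_eq_iff)
  ultimately show ?thesis by simp
qed

lemma continuous_bounded_on_cball:
  fixes f :: "real ^ 'n::finite \<Rightarrow> real"
  assumes "continuous_on UNIV f"
  shows "\<exists>B\<ge>0. \<forall>x. dist x c \<le> R \<longrightarrow> \<bar>f x\<bar> \<le> B"
proof -
  have "compact (f ` cball c R)"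
    by (intro compact_continuous_image continuous_on_subset[OF assms]) auto
  then have "bounded (f ` cball c R)"
    by (rule compact_imp_bounded)
  then obtain B where B: "\<And>y. y \<in> f ` cball c R \<Longrightarrow> norm y \<le> B"
    by (auto simp: bounded_iff)
  have "\<bar>f x\<bar> \<le> max B 0" if "dist x c \<le> R" for x
    using B[of "f x"] that by (simp add: dist_commute le_max_iff_disj)
  then show ?thesis
    by (intro exI[of _ "max B 0"]) auto
qed

lemma continuous_if_continuous_pd:
  fixes u :: "real ^ 'n::finite \<Rightarrow> real"
  assumes pd: "\<And>i x. has_pd i u x (u' i x)"
    and cont: "\<And>i. continuous_on UNIV (u' i)"
  shows "continuous_on UNIV u"
proof -
  have "isCont u x" for x
  proof -
    have "continuous_on UNIV (\<lambda>y. \<Sum>i\<in>UNIV. \<bar>u' i y\<bar>)"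
      by (intro continuous_intros cont)
    then obtain B where B: "\<And>y. dist y x \<le> 1 \<Longrightarrow> \<bar>\<Sum>i\<in>UNIV. \<bar>u' i y\<bar>\<bar> \<le> B"
      using continuous_bounded_on_cball[of _ x 1] by metis
    have bound: "\<bar>u' i y\<bar> \<le> B" if "dist y x \<le> 1" for i y
    proof -
      have "\<bar>u' i y\<bar> \<le> (\<Sum>i\<in>UNIV. \<bar>u' i y\<bar>)"
        by (rule member_le_sum) auto
      also have "\<dots> \<le> \<bar>\<Sum>i\<in>UNIV. \<bar>u' i y\<bar>\<bar>" by simp
      also have "\<dots> \<le> B" using B[OF that] .
      finally show ?thesis .
    qed
    have le: "\<bar>u (x + h) - u x\<bar> \<le> B * (\<Sum>i\<in>UNIV. \<bar>h $ i\<bar>)" if "norm h \<le> 1" for h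
      by (rule increment_le_pd_bound[OF pd bound that])
    have "isCont (\<lambda>h :: real ^ 'n. B * (\<Sum>i\<in>UNIV. \<bar>h $ i\<bar>)) 0"
      by (intro continuous_intros)
    then have lim: "((\<lambda>h :: real ^ 'n. B * (\<Sum>i\<in>UNIV. \<bar>h $ i\<bar>)) \<longlongrightarrow> 0) (at 0)"
      by (simp add: isCont_def)
    have "eventually (\<lambda>h. norm (u (x + h) - u x) \<le> B * (\<Sum>i\<in>UNIV. \<bar>h $ i\<bar>)) (at 0)"
      unfolding eventually_at using le by (intro exI[of _ 1]) (auto simp: dist_norm)
    then have "((\<lambda>h. u (x + h) - u x) \<longlongrightarrow> 0) (at 0)"
      using lim by (rule Lim_null_comparison)
    then show ?thesis
      by (simp add: isCont_iff LIM_zero_iff)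
  qed
  then show ?thesis
    by (simp add: continuous_at_imp_continuous_on)
qed

text \<open>Both mixed derivatives are limits of the same second difference, by the mean value theorem applied
in the two possible orders.\<close>

lemma pd_commute:
  fixes u :: "real ^ 'n::finite \<Rightarrow> real"
  assumes pd: "\<And>i x. has_pd i u x (u' i x)"
    and pd2: "\<And>i j x. has_pd i (u' j) x (u'' i j x)"
    and cont: "\<And>i j. continuous_on UNIV (u'' i j)"
  shows "u'' i j x = u'' j i x"
proof (rule ccontr)
  assume neq: "u'' i j x \<noteq> u'' j i x"
  define \<epsilon> where "\<epsilon> = \<bar>u'' i j x - u'' j i x\<bar> / 2"
  have "\<epsilon> > 0" using neq by (simp add: \<epsilon>_def)
  have near: "\<exists>\<delta>>0. \<forall>y. dist y x < \<delta> \<longrightarrow> \<bar>u'' i j y - u'' i j x\<bar> < \<epsilon>" for i j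
    using cont[of i j] \<open>\<epsilon> > 0\<close>
    unfolding continuous_on_iff by (auto simp: dist_real_def)
  obtain \<delta>1 where \<delta>1: "\<delta>1 > 0" "\<And>y. dist y x < \<delta>1 \<Longrightarrow> \<bar>u'' i j y - u'' i j x\<bar> < \<epsilon>"
    using near[of i j] by blast
  obtain \<delta>2 where \<delta>2: "\<delta>2 > 0" "\<And>y. dist y x < \<delta>2 \<Longrightarrow> \<bar>u'' j i y - u'' j i x\<bar> < \<epsilon>"
    using near[of j i] by blast
  define h where "h = min \<delta>1 \<delta>2 / 3"
  have h: "h > 0" "2 * h < \<delta>1" "2 * h < \<delta>2"
    using \<delta>1(1) \<delta>2(1) by (auto simp: h_def min_def)
  let ?e = "\<lambda>i. axis i (1::real) :: real ^ 'n"
  have second_difference: "\<exists>y. dist y x \<le> 2 * h \<and>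
      u (x + h *\<^sub>R ?e k + h *\<^sub>R ?e l) - u (x + h *\<^sub>R ?e k) - u (x + h *\<^sub>R ?e l) + u x = h * h * u'' l k y"
    for k l
  proof -
    have "has_pd k (\<lambda>x. u (x + h *\<^sub>R ?e l) - u x) x (u' k (x + h *\<^sub>R ?e l) - u' k x)" for x
      by (intro has_pd_diff has_pd_shift pd)
    from pd_mean_value[of k "\<lambda>x. u (x + h *\<^sub>R ?e l) - u x", OF this, of h x]
    obtain z where z: "\<bar>z\<bar> \<le> \<bar>h\<bar>"
      "u (x + h *\<^sub>R ?e k + h *\<^sub>R ?e l) - u (x + h *\<^sub>R ?e k) - (u (x + h *\<^sub>R ?e l) - u x)
        = h * (u' k (x + z *\<^sub>R ?e k + h *\<^sub>R ?e l) - u' k (x + z *\<^sub>R ?e k))"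
      by blast
    from pd_mean_value[of l "u' k" "u'' l k" h "x + z *\<^sub>R ?e k", OF pd2]
    obtain w where w: "\<bar>w\<bar> \<le> \<bar>h\<bar>"
      "u' k (x + z *\<^sub>R ?e k + h *\<^sub>R ?e l) - u' k (x + z *\<^sub>R ?e k)
        = h * u'' l k (x + z *\<^sub>R ?e k + w *\<^sub>R ?e l)"
      by blast
    have "norm (z *\<^sub>R ?e k + w *\<^sub>R ?e l) \<le> \<bar>z\<bar> + \<bar>w\<bar>"
      using norm_triangle_ineq[of "z *\<^sub>R ?e k" "w *\<^sub>R ?e l"] by (simp add: norm_axis_1)
    then have "dist (x + z *\<^sub>R ?e k + w *\<^sub>R ?e l) x \<le> 2 * h"
      using z(1) w(1) h by (simp add: dist_norm algebra_simps)
    with z(2) w(2) show ?thesis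
      by (intro exI[of _ "x + z *\<^sub>R ?e k + w *\<^sub>R ?e l"]) (simp add: algebra_simps)
  qed
  obtain y where y: "dist y x \<le> 2 * h"
    "u (x + h *\<^sub>R ?e j + h *\<^sub>R ?e i) - u (x + h *\<^sub>R ?e j) - u (x + h *\<^sub>R ?e i) + u x = h * h * u'' i j y"
    using second_difference by blast
  obtain y' where y': "dist y' x \<le> 2 * h"
    "u (x + h *\<^sub>R ?e i + h *\<^sub>R ?e j) - u (x + h *\<^sub>R ?e i) - u (x + h *\<^sub>R ?e j) + u x = h * h * u'' j i y'"
    using second_difference by blast
  have "h * h * u'' i j y = h * h * u'' j i y'"
    using y(2) y'(2) by (simp add: algebra_simps)
  then have "u'' i j y = u'' j i y'" using h by simp
  moreover have "\<bar>u'' i j y - u'' i j x\<bar> < \<epsilon>" "\<bar>u'' j i y' - u'' j i x\<bar> < \<epsilon>"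
    using \<delta>1 \<delta>2 y y' h by auto
  ultimately show False
    unfolding \<epsilon>_def by (smt (verit) field_sum_of_halves)
qed

lemma C1_has_pd: "C1_on_UNIV f \<Longrightarrow> has_pd i f x (partial i f x)"
  by (simp add: C1_on_UNIV_def has_partial_def has_pd_def partial_def DERIV_deriv_iff_real_differentiable)

lemma C1_continuous_partial: "C1_on_UNIV f \<Longrightarrow> continuous_on UNIV (partial i f)"
  by (simp add: C1_on_UNIV_def)

section \<open>Integration by parts\<close>

lemma integrable_continuous_support:
  fixes F :: "real ^ 'n::finite \<Rightarrow> real"
  assumes "continuous_on UNIV F" "\<And>x. norm x > R \<Longrightarrow> F x = 0"
  shows "integrable lborel F"
proof -
  have "integrable lborel (\<lambda>x. indicator (cball 0 R) x *\<^sub>R F x)"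
    by (intro borel_integrable_compact continuous_on_subset[OF assms(1)]) auto
  moreover have "(\<lambda>x. indicator (cball 0 R) x *\<^sub>R F x) = F"
    using assms(2) by (force simp: indicator_def)
  ultimately show ?thesis by simp
qed

lemma integral_limit_bounded_support:
  fixes F :: "nat \<Rightarrow> real ^ 'n::finite \<Rightarrow> real"
  assumes "\<And>m. continuous_on UNIV (F m)" "continuous_on UNIV f"
    and "\<And>m x. norm x > R \<Longrightarrow> F m x = 0"
    and "\<And>m x. norm x \<le> R \<Longrightarrow> \<bar>F m x\<bar> \<le> B"
    and "\<And>x. (\<lambda>m. F m x) \<longlonglongrightarrow> f x"
  shows "(\<lambda>m. integral\<^sup>L lborel (F m)) \<longlonglongrightarrow> integral\<^sup>L lborel f"
proof (rule integral_dominated_convergence[where w="\<lambda>x. B * indicator (cball 0 R) x"])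
  show "f \<in> borel_measurable lborel" "F m \<in> borel_measurable lborel" for m
    using assms(1,2) by (simp_all add: borel_measurable_continuous_onI)
  show "integrable lborel (\<lambda>x. B * indicator (cball 0 R) x)"
    using emeasure_lborel_cball_finite by (intro integrable_mult_right) (auto simp: integrable_indicator_iff)
  show "AE x in lborel. (\<lambda>m. F m x) \<longlonglongrightarrow> f x"
    using assms(5) by simp
  show "AE x in lborel. norm (F m x) \<le> B * indicator (cball 0 R) x" for m
    using assms(3,4) by (intro AE_I2) (force simp: indicator_def)
qed

lemma integral_translate:
  fixes F :: "real ^ 'n::finite \<Rightarrow> real"
  assumes "continuous_on UNIV F"
  shows "integral\<^sup>L lborel (\<lambda>x. F (x + c)) = integral\<^sup>L lborel F"
proof -
  have "F \<in> borel_measurable borel"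
    using assms by (rule borel_measurable_continuous_onI)
  then have "integral\<^sup>L (distr lborel borel ((+) c)) F = integral\<^sup>L lborel (\<lambda>x. F (c + x))"
    by (intro integral_distr) auto
  then show ?thesis
    by (simp add: lborel_distr_plus add.commute)
qed

lemma difference_quotient_tendsto:
  fixes f :: "real ^ 'n::finite \<Rightarrow> real"
  assumes "has_pd i f x d"
  shows "(\<lambda>m. (f (x + (1 / Suc m) *\<^sub>R axis i 1) - f x) * Suc m) \<longlonglongrightarrow> d"
proof -
  have "((\<lambda>h. (f (x + h *\<^sub>R axis i 1) - f x) / h) \<longlongrightarrow> d) (at 0)"
    using assms by (simp add: has_pd_def DERIV_def)
  moreover have "filterlim (\<lambda>m. 1 / real (Suc m)) (at 0) sequentially"
    unfolding filterlim_at
    using LIMSEQ_inverse_real_of_nat by (simp add: inverse_eq_divide del: of_nat_Suc)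
  ultimately have "(\<lambda>m. (f (x + (1 / Suc m) *\<^sub>R axis i 1) - f x) / (1 / Suc m)) \<longlonglongrightarrow> d"
    by (rule filterlim_compose)
  then show ?thesis by simp
qed

lemma difference_quotient_bounded:
  fixes f :: "real ^ 'n::finite \<Rightarrow> real"
  assumes "\<And>x. has_pd i f x (f' x)" "continuous_on UNIV f'"
  shows "\<exists>B\<ge>0. \<forall>m x. norm x \<le> R \<longrightarrow> \<bar>(f (x + (1 / Suc m) *\<^sub>R axis i 1) - f x) * Suc m\<bar> \<le> B"
proof -
  obtain B where B: "B \<ge> 0" "\<forall>x. norm x \<le> R + 1 \<longrightarrow> \<bar>f' x\<bar> \<le> B"
    using continuous_bounded_on_cball[OF assms(2), of 0] by auto
  have "\<bar>(f (x + (1 / Suc m) *\<^sub>R axis i 1) - f x) * Suc m\<bar> \<le> B" if "norm x \<le> R" for m x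
  proof -
    obtain z where z: "\<bar>z\<bar> \<le> \<bar>1 / Suc m\<bar>"
      "f (x + (1 / Suc m) *\<^sub>R axis i 1) - f x = (1 / Suc m) * f' (x + z *\<^sub>R axis i 1)"
      using pd_mean_value[OF assms(1)] by blast
    have "\<bar>z\<bar> \<le> 1" using z(1) by (rule order_trans) simp
    then have "norm (x + z *\<^sub>R axis i 1) \<le> R + 1"
      using norm_triangle_ineq[of x "z *\<^sub>R axis i 1"] that by (simp add: norm_axis_1)
    then show ?thesis using z(2) B by simp
  qed
  with B(1) show ?thesis by blast
qed

text \<open>The divergence theorem for compactly supported functions: the difference quotients have integral
zero by translation invariance, and they converge boundedly to the derivative.\<close>

lemma integral_pd_eq_0:
  fixes F :: "real ^ 'n::finite \<Rightarrow> real"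
  assumes pd: "\<And>x. has_pd i F x (F' x)"
    and cont: "continuous_on UNIV F" "continuous_on UNIV F'"
    and supp: "\<And>x. norm x > R \<Longrightarrow> F x = 0"
  shows "integral\<^sup>L lborel F' = 0"
proof -
  let ?Q = "\<lambda>m x. (F (x + (1 / Suc m) *\<^sub>R axis i 1) - F x) * Suc m"
  obtain B where B: "B \<ge> 0" "\<forall>m x. norm x \<le> R + 1 \<longrightarrow> \<bar>?Q m x\<bar> \<le> B"
    using difference_quotient_bounded[OF pd cont(2)] by blast
  have contS: "continuous_on UNIV (\<lambda>x. F (x + c))" for c
    by (rule continuous_on_compose2[OF cont(1)]) (auto intro!: continuous_intros)
  have suppS: "F (x + (1 / Suc m) *\<^sub>R axis i 1) = 0" if "norm x > R + 1" for m x
  proof (rule supp)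
    have "norm x \<le> norm (x + (1 / Suc m) *\<^sub>R axis i 1) + norm ((1 / Suc m) *\<^sub>R axis i (1::real) :: real ^ 'n)"
      using norm_triangle_ineq4[of "x + (1 / Suc m) *\<^sub>R axis i 1" "(1 / Suc m) *\<^sub>R axis i 1"] by simp
    moreover have "norm ((1 / Suc m) *\<^sub>R axis i (1::real) :: real ^ 'n) \<le> 1"
      by (simp add: norm_axis_1)
    ultimately show "norm (x + (1 / Suc m) *\<^sub>R axis i 1) > R" using that by linarith
  qed
  have "(\<lambda>m. integral\<^sup>L lborel (?Q m)) \<longlonglongrightarrow> integral\<^sup>L lborel F'"
  proof (rule integral_limit_bounded_support)
    show "continuous_on UNIV (?Q m)" for m
      by (intro continuous_intros contS cont)
    show "?Q m x = 0" if "norm x > R + 1" for m x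
      using suppS[OF that] supp[of x] that by simp
    show "\<And>m x. norm x \<le> R + 1 \<Longrightarrow> \<bar>?Q m x\<bar> \<le> B" using B by blast
    show "\<And>x. (\<lambda>m. ?Q m x) \<longlonglongrightarrow> F' x"
      by (rule difference_quotient_tendsto[OF pd])
  qed (fact cont)
  moreover have "integral\<^sup>L lborel (?Q m) = 0" for m
  proof -
    have "integrable lborel F"
      using cont(1) supp by (rule integrable_continuous_support)
    moreover have "integrable lborel (\<lambda>x. F (x + (1 / Suc m) *\<^sub>R axis i 1))"
      using contS suppS by (rule integrable_continuous_support)
    ultimately show ?thesis
      using integral_translate[OF cont(1), of "(1 / Suc m) *\<^sub>R axis i 1"] by simp
  qed
  ultimately show ?thesis
    by (simp add: LIMSEQ_const_iff del: of_nat_Suc)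
qed

lemma pd_eq_0_outside_support:
  fixes f :: "real ^ 'n::finite \<Rightarrow> real"
  assumes "has_pd i f x d" "\<And>x. norm x > R \<Longrightarrow> f x = 0" "norm x > R"
  shows "d = 0"
proof -
  have "((\<lambda>t. norm (x + t *\<^sub>R axis i (1::real))) \<longlongrightarrow> norm (x + 0 *\<^sub>R axis i (1::real))) (nhds 0)"
    by (intro tendsto_intros tendsto_ident_at filterlim_ident)
  then have "eventually (\<lambda>t. norm (x + t *\<^sub>R axis i (1::real)) > R) (nhds 0)"
    using assms(3) by (intro order_tendstoD) auto
  then have "eventually (\<lambda>t. f (x + t *\<^sub>R axis i 1) = 0) (nhds 0)"
    by eventually_elim (rule assms(2))
  then have "((\<lambda>t. f (x + t *\<^sub>R axis i 1)) has_real_derivative d) (at 0) \<longleftrightarrow> ((\<lambda>_. 0::real) has_real_derivative d) (at 0)"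
    by (intro DERIV_cong_ev) auto
  then have "((\<lambda>_. 0::real) has_real_derivative d) (at 0)"
    using assms(1) by (simp add: has_pd_def)
  then show ?thesis
    using DERIV_unique DERIV_const by blast
qed

text \<open>For \<open>u\<close> with three continuous derivatives this is the divergence theorem for
\<open>\<phi> (\<partial>\<^sub>j u) \<nabla>(\<partial>\<^sub>j u)\<close>. For \<open>u\<close> with two continuous derivatives and a continuously
differentiable Laplacian, the factor \<open>\<nabla>(\<partial>\<^sub>j u)\<close> is replaced by the difference quotient of \<open>\<nabla>u\<close> in
direction \<open>j\<close>. That field is differentiable, third derivatives are represented in its divergence by
the difference quotient of the Laplacian alone, and everything converges as the step tends to zero.\<close>

lemma weak_bochner:
  fixes u :: "real ^ 'n::finite \<Rightarrow> real"
  assumes pd: "\<And>i x. has_pd i u x (u' i x)"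
    and pd2: "\<And>i j x. has_pd i (u' j) x (u'' i j x)"
    and cont: "\<And>i j. continuous_on UNIV (u'' i j)"
    and L: "\<And>x. has_pd j (\<lambda>x. \<Sum>i\<in>UNIV. u'' i i x) x (L' x)" "continuous_on UNIV L'"
    and \<phi>: "\<And>i x. has_pd i \<phi> x (\<phi>' i x)" "\<And>i. continuous_on UNIV (\<phi>' i)"
    and supp: "\<And>x. norm x > R \<Longrightarrow> \<phi> x = 0"
  shows "integral\<^sup>L lborel (\<lambda>x. L' x * (u' j x * \<phi> x)
      + (\<Sum>i\<in>UNIV. u'' j i x * (u'' i j x * \<phi> x + u' j x * \<phi>' i x))) = 0"
proof -
  \<comment> \<open>Difference quotients in direction \<open>j\<close> with step \<open>1 / (m + 1)\<close>.\<close>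
  define q where "q = (\<lambda>f m (x :: real ^ 'n). (f (x + (1 / Suc m) *\<^sub>R axis j 1) - f x :: real) * Suc m)"
  have cu': "continuous_on UNIV (u' i)" for i
    using continuous_if_continuous_pd[OF pd2 cont] .
  have c\<phi>: "continuous_on UNIV \<phi>"
    using continuous_if_continuous_pd[OF \<phi>] .
  have cq: "continuous_on UNIV (q f m)" if "continuous_on UNIV f" for f m
    unfolding q_def
    by (intro continuous_intros that continuous_on_compose2[OF that]) auto
  define G where "G = (\<lambda>i x. u'' i j x * \<phi> x + u' j x * \<phi>' i x)"
  have cG: "continuous_on UNIV (G i)" for i
    unfolding G_def by (intro continuous_intros cont c\<phi> \<phi> cu')
  have pdG: "has_pd i (\<lambda>x. u' j x * \<phi> x) x (G i x)" for i x
    unfolding G_def by (intro has_pd_mult pd2 \<phi>)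
  have suppG: "G i x = 0" if "norm x > R" for i x
    using pd_eq_0_outside_support[OF pdG _ that] supp by auto
  let ?lap = "\<lambda>x. \<Sum>i\<in>UNIV. u'' i i x"
  have clap: "continuous_on UNIV ?lap"
    by (intro continuous_intros cont)
  define S where "S = (\<lambda>m x. q ?lap m x * (u' j x * \<phi> x) + (\<Sum>i\<in>UNIV. q (u' i) m x * G i x))"
  have S0: "integral\<^sup>L lborel (S m) = 0" for m
  proof -
    let ?F = "\<lambda>i x. q (u'' i i) m x * (u' j x * \<phi> x) + q (u' i) m x * G i x"
    have "has_pd i (q (u' i) m) x (q (u'' i i) m x)" for i x
    proof -
      have "has_pd i (\<lambda>x. Suc m * (u' i (x + (1 / Suc m) *\<^sub>R axis j 1) - u' i x)) x
        (Suc m * (u'' i i (x + (1 / Suc m) *\<^sub>R axis j 1) - u'' i i x))"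
        by (intro has_pd_cmult has_pd_diff has_pd_shift pd2)
      then show ?thesis by (simp add: q_def mult.commute)
    qed
    then have F: "has_pd i (\<lambda>x. q (u' i) m x * (u' j x * \<phi> x)) x (?F i x)" for i x
      by (intro has_pd_mult pdG)
    have cF: "continuous_on UNIV (?F i)" for i
      by (intro continuous_intros cq cG cont c\<phi> cu')
    have suppF: "?F i x = 0" if "norm x > R" for i x
      using that by (simp add: supp suppG)
    have int: "integrable lborel (?F i)" for i
      using cF suppF by (rule integrable_continuous_support)
    have "integral\<^sup>L lborel (?F i) = 0" for i
      by (rule integral_pd_eq_0[where R=R, OF F _ cF])
        (auto intro!: continuous_intros cq c\<phi> cu' simp: supp)
    then have "integral\<^sup>L lborel (\<lambda>x. \<Sum>i\<in>UNIV. ?F i x) = 0"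
      using int by (simp add: Bochner_Integration.integral_sum del: Bochner_Integration.integral_add)
    moreover have "(\<lambda>x. \<Sum>i\<in>UNIV. ?F i x) = S m"
      by (rule ext) (simp add: S_def q_def sum.distrib sum_distrib_left sum_distrib_right sum_subtractf right_diff_distrib left_diff_distrib)
    ultimately show ?thesis by simp
  qed
  have bq: "\<exists>B\<ge>0. \<forall>m x. norm x \<le> R \<longrightarrow> \<bar>q f m x\<bar> \<le> B"
    if "\<And>x. has_pd j f x (f' x)" "continuous_on UNIV f'" for f f'
    using difference_quotient_bounded[OF that] unfolding q_def .
  obtain B where B: "B \<ge> 0" "\<And>m x. norm x \<le> R \<Longrightarrow> \<bar>q ?lap m x\<bar> \<le> B"
    using bq[OF L] by blast
  have "\<exists>B\<ge>0. \<forall>m x. norm x \<le> R \<longrightarrow> \<bar>q (u' i) m x\<bar> \<le> B" for i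
    using bq[OF pd2 cont] .
  then obtain Bi where Bi: "\<And>i. Bi i \<ge> 0" "\<And>i m x. norm x \<le> R \<Longrightarrow> \<bar>q (u' i) m x\<bar> \<le> Bi i"
    by metis
  have "\<exists>B\<ge>0. \<forall>x. dist x 0 \<le> R \<longrightarrow> \<bar>u' j x * \<phi> x\<bar> \<le> B"
    by (intro continuous_bounded_on_cball continuous_intros cu' c\<phi>)
  then obtain C where C: "C \<ge> 0" "\<And>x. norm x \<le> R \<Longrightarrow> \<bar>u' j x * \<phi> x\<bar> \<le> C"
    by auto
  have "\<exists>B\<ge>0. \<forall>x. dist x 0 \<le> R \<longrightarrow> \<bar>G i x\<bar> \<le> B" for i
    by (intro continuous_bounded_on_cball cG)
  then obtain Ci where Ci: "\<And>i. Ci i \<ge> 0" "\<And>i x. norm x \<le> R \<Longrightarrow> \<bar>G i x\<bar> \<le> Ci i"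
    by (metis dist_0_norm dist_commute)
  let ?T = "\<lambda>x. L' x * (u' j x * \<phi> x) + (\<Sum>i\<in>UNIV. u'' j i x * G i x)"
  have "(\<lambda>m. integral\<^sup>L lborel (S m)) \<longlonglongrightarrow> integral\<^sup>L lborel ?T"
  proof (rule integral_limit_bounded_support)
    show "continuous_on UNIV (S m)" for m
      unfolding S_def by (intro continuous_intros cq clap cu' c\<phi> cG)
    show "continuous_on UNIV ?T"
      by (intro continuous_intros cu' c\<phi> cG L cont)
    show "S m x = 0" if "norm x > R" for m x
      using that by (simp add: S_def supp suppG)
    show "\<bar>S m x\<bar> \<le> B * C + (\<Sum>i\<in>UNIV. Bi i * Ci i)" if "norm x \<le> R" for m x
    proof -
      have "\<bar>S m x\<bar> \<le> \<bar>q ?lap m x * (u' j x * \<phi> x)\<bar> + \<bar>\<Sum>i\<in>UNIV. q (u' i) m x * G i x\<bar>"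
        unfolding S_def by (rule abs_triangle_ineq)
      also have "\<dots> \<le> \<bar>q ?lap m x\<bar> * \<bar>u' j x * \<phi> x\<bar> + (\<Sum>i\<in>UNIV. \<bar>q (u' i) m x\<bar> * \<bar>G i x\<bar>)"
        using sum_abs[of "\<lambda>i. q (u' i) m x * G i x" UNIV] by (simp add: abs_mult)
      also have "\<dots> \<le> B * C + (\<Sum>i\<in>UNIV. Bi i * Ci i)"
        by (intro add_mono sum_mono mult_mono B C Bi Ci that) auto
      finally show ?thesis .
    qed
    show "(\<lambda>m. S m x) \<longlonglongrightarrow> ?T x" for x
    proof -
      have "(\<lambda>m. q ?lap m x) \<longlonglongrightarrow> L' x"
        unfolding q_def by (rule difference_quotient_tendsto[OF L(1)])
      moreover have "(\<lambda>m. q (u' i) m x) \<longlonglongrightarrow> u'' j i x" for i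
        unfolding q_def by (rule difference_quotient_tendsto[OF pd2])
      ultimately show ?thesis
        unfolding S_def by (intro tendsto_intros)
    qed
  qed
  then show ?thesis
    by (simp add: S0 LIMSEQ_const_iff G_def)
qed

section \<open>Superharmonic functions\<close>

lemma second_derivative_nonneg_at_min:
  fixes \<phi> :: "real \<Rightarrow> real"
  assumes "\<epsilon> > 0" "\<And>t. \<bar>t\<bar> < \<epsilon> \<Longrightarrow> (\<phi> has_real_derivative \<phi>' t) (at t)"
    "(\<phi>' has_real_derivative D) (at 0)" "\<And>t. \<bar>t\<bar> < \<epsilon> \<Longrightarrow> \<phi> 0 \<le> \<phi> t"
  shows "D \<ge> 0"
proof (rule ccontr)
  assume "\<not> D \<ge> 0"
  have "\<phi>' 0 = 0"
    by (rule DERIV_local_min[of \<phi> _ 0 \<epsilon>]) (use assms in auto)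
  moreover obtain d where d: "d > 0" "\<And>h. 0 < h \<Longrightarrow> h < d \<Longrightarrow> \<phi>' h < \<phi>' 0"
    using DERIV_neg_dec_right[OF assms(3)] \<open>\<not> D \<ge> 0\<close> by auto
  moreover define t where "t = min d \<epsilon> / 2"
  have t: "0 < t" "t < d" "t < \<epsilon>"
    using \<open>d > 0\<close> \<open>\<epsilon> > 0\<close> by (auto simp: t_def min_def)
  moreover obtain z where "0 < z" "z < t" "\<phi> t - \<phi> 0 = (t - 0) * \<phi>' z"
    using MVT2[of 0 t \<phi> \<phi>'] assms(2) t by (metis abs_of_nonneg order.strict_trans1)
  ultimately have "\<phi> t - \<phi> 0 < 0"
    by (metis diff_zero dual_order.strict_trans mult_pos_neg)
  then show False
    using assms(4)[of t] t by simp
qed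

lemma has_pd_sq_dist:
  fixes x c :: "real ^ 'n::finite"
  shows "has_pd i (\<lambda>x. (norm (x - c))\<^sup>2) x (2 * (x $ i - c $ i))"
proof -
  have "has_pd i (\<lambda>x. \<Sum>j\<in>UNIV. (x $ j - c $ j) * (x $ j - c $ j)) x
    (\<Sum>j\<in>UNIV. ((if j = i then 1 else 0) - 0) * (x $ j - c $ j) + (x $ j - c $ j) * ((if j = i then 1 else 0) - 0))"
    by (intro has_pd_sum has_pd_mult has_pd_diff has_pd_nth has_pd_const)
  moreover have "(\<lambda>x. \<Sum>j\<in>UNIV. (x $ j - c $ j) * (x $ j - c $ j)) = (\<lambda>x. (norm (x - c))\<^sup>2)"
    by (simp add: power2_norm_eq_inner inner_vec_def)
  moreover have "(\<Sum>j\<in>UNIV. ((if j = i then 1 else 0) - 0) * (x $ j - c $ j) + (x $ j - c $ j) * ((if j = i then 1 else 0) - 0))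
     = 2 * (x $ i - c $ i)"
    by (simp add: sum.distrib if_distrib if_distribR cong: if_cong)
  ultimately show ?thesis by simp
qed

text \<open>The function \<open>h\<close> is \<open>|x - c|\<^sup>2\<^sup>-\<^sup>n\<close>, written as a power of the smooth function
\<open>|x - c|\<^sup>2\<close>. Adding the strictly superharmonic \<open>\<delta> (R\<^sup>2 - |x - c|\<^sup>2)\<close> rules out an interior minimum of
the difference; then \<open>\<delta>\<close> tends to zero.\<close>

lemma superharmonic_ge_on_annulus:
  fixes u :: "real ^ 'n::finite \<Rightarrow> real" and c :: "real ^ 'n"
  defines "n \<equiv> real CARD('n)"
  defines "h \<equiv> \<lambda>x. ((norm (x - c))\<^sup>2) powr (1 - n / 2)"
  assumes pd: "\<And>i x. has_pd i u x (u' i x)"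
    and pd2: "\<And>i j x. has_pd i (u' j) x (u'' i j x)"
    and cont: "continuous_on UNIV u"
    and superharmonic: "\<And>x. (\<Sum>i\<in>UNIV. u'' i i x) \<le> 0"
    and nonneg: "\<And>x. u x \<ge> 0"
    and r: "0 < r" "r \<le> R" and \<mu>: "\<mu> \<ge> 0"
    and inner: "\<And>x. norm (x - c) = r \<Longrightarrow> u x \<ge> \<mu> * (r\<^sup>2) powr (1 - n / 2)"
    and x: "r \<le> norm (x - c)" "norm (x - c) \<le> R"
  shows "u x \<ge> \<mu> * (h x - (R\<^sup>2) powr (1 - n / 2))"
proof -
  define hR where "hR = (R\<^sup>2) powr (1 - n / 2)"
  define K where "K = cball c R - ball c r"
  have "compact K"
    unfolding K_def by (intro compact_diff) auto
  have inK: "y \<in> K \<longleftrightarrow> r \<le> norm (y - c) \<and> norm (y - c) \<le> R" for y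
    by (auto simp: K_def dist_norm norm_minus_commute)
  have "x \<in> K" using x inK by blast
  have ge: "u x \<ge> \<mu> * (h x - (R\<^sup>2) powr (1 - n / 2)) - \<delta> * (R\<^sup>2 - (norm (x - c))\<^sup>2)" if "\<delta> > 0" for \<delta>
  proof -
    define w where "w = (\<lambda>x. u x - \<mu> * (h x - hR) + \<delta> * (R\<^sup>2 - (norm (x - c))\<^sup>2))"
    define w' where "w' = (\<lambda>i x. u' i x - \<mu> * ((1 - n / 2) * (((norm (x - c))\<^sup>2) powr (- n / 2) * (2 * (x $ i - c $ i))))
      + \<delta> * (0 - 2 * (x $ i - c $ i)))"
    define w'' where "w'' = (\<lambda>i x. u'' i i x - \<mu> * ((1 - n / 2) * ((- n / 2 * ((norm (x - c))\<^sup>2) powr (- n / 2 - 1) * (2 * (x $ i - c $ i))) * (2 * (x $ i - c $ i))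
       + ((norm (x - c))\<^sup>2) powr (- n / 2) * 2)) + \<delta> * (- 2))"
    have contw: "continuous_on K w"
      unfolding w_def h_def using r
      by (intro continuous_intros continuous_on_subset[OF cont]) (auto simp: inK)
    obtain z where z: "z \<in> K" "\<And>y. y \<in> K \<Longrightarrow> w z \<le> w y"
      using continuous_attains_inf[OF \<open>compact K\<close> _ contw] \<open>x \<in> K\<close> by blast
    have pos: "(norm (y - c))\<^sup>2 > 0" if "norm (y - c) > r" for y
      using r that by (auto intro!: zero_less_power elim: order.strict_trans)
    have dw: "has_pd i w y (w' i y)" if "norm (y - c) > r" for i y
    proof -
      have "has_pd i h y ((1 - n / 2) * ((norm (y - c))\<^sup>2) powr (1 - n / 2 - 1) * (2 * (y $ i - c $ i)))"
        unfolding h_def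
        by (rule has_pd_chain[OF _ has_pd_sq_dist])
          (use pos[OF that] in \<open>auto intro!: derivative_eq_intros\<close>)
      then have "has_pd i h y ((1 - n / 2) * (((norm (y - c))\<^sup>2) powr (- n / 2) * (2 * (y $ i - c $ i))) - 0)"
        by (simp add: mult.assoc)
      then show ?thesis
        unfolding w_def w'_def
        using has_pd_diff[OF _ has_pd_const[of i hR y]]
        by (intro has_pd_add has_pd_diff has_pd_cmult pd has_pd_const has_pd_sq_dist) fastforce+
    qed
    have dw': "has_pd i (w' i) y (w'' i y)" if "norm (y - c) > r" for i y
    proof -
      have *: "has_pd i (\<lambda>y. ((norm (y - c))\<^sup>2) powr (- n / 2)) y (- n / 2 * ((norm (y - c))\<^sup>2) powr (- n / 2 - 1) * (2 * (y $ i - c $ i)))"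
        by (rule has_pd_chain[OF _ has_pd_sq_dist])
          (use pos[OF that] in \<open>auto intro!: derivative_eq_intros\<close>)
      have lin: "has_pd i (\<lambda>y. 2 * (y $ i - c $ i)) y 2"
        using has_pd_cmult[OF has_pd_diff[OF has_pd_nth[of i i y] has_pd_const[of i "c $ i" y]], of 2] by simp
      have "has_pd i (\<lambda>y. 0 - 2 * (y $ i - c $ i)) y (- 2)"
        using has_pd_diff[OF has_pd_const[of i 0 y] lin] by simp
      from has_pd_add[OF has_pd_diff[OF pd2 has_pd_cmult[OF has_pd_cmult[OF has_pd_mult[OF * lin]]]] has_pd_cmult[OF this]]
      show ?thesis
        unfolding w'_def w''_def by (simp only: mult.assoc)
    qed
    have "w z \<ge> 0"
    proof (rule ccontr)
      assume "\<not> w z \<ge> 0"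
      have "norm (z - c) \<noteq> r"
      proof
        assume eq: "norm (z - c) = r"
        have "r\<^sup>2 \<le> R\<^sup>2" using r by (simp add: power_mono)
        moreover have "hR \<ge> 0" by (simp add: hR_def)
        then have "\<mu> * (h z - hR) \<le> \<mu> * h z"
          using \<mu> by (intro mult_left_mono) auto
        ultimately have "w z \<ge> 0"
          using inner[OF eq] \<open>\<delta> > 0\<close> by (simp add: w_def h_def eq add_nonneg_nonneg)
        with \<open>\<not> w z \<ge> 0\<close> show False by simp
      qed
      moreover have "norm (z - c) \<noteq> R"
        using \<open>\<not> w z \<ge> 0\<close> nonneg[of z] by (auto simp: w_def h_def hR_def)
      ultimately have z_int: "r < norm (z - c)" "norm (z - c) < R"
        using z(1) by (auto simp: inK)
      have "w'' i z \<ge> 0" for i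
      proof (rule second_derivative_nonneg_at_min)
        define \<epsilon> where "\<epsilon> = min (norm (z - c) - r) (R - norm (z - c))"
        show "\<epsilon> > 0" using z_int by (simp add: \<epsilon>_def)
        have near: "r < norm (z + t *\<^sub>R axis i 1 - c)" "norm (z + t *\<^sub>R axis i 1 - c) < R"
          if "\<bar>t\<bar> < \<epsilon>" for t
        proof -
          have "\<bar>norm (z + t *\<^sub>R axis i 1 - c) - norm (z - c)\<bar> \<le> norm (t *\<^sub>R axis i (1::real) :: real ^ 'n)"
            using norm_triangle_ineq3[of "z + t *\<^sub>R axis i 1 - c" "z - c"] by (simp add: algebra_simps)
          then show "r < norm (z + t *\<^sub>R axis i 1 - c)" "norm (z + t *\<^sub>R axis i 1 - c) < R"
            using that by (auto simp: \<epsilon>_def)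
        qed
        show "((\<lambda>t. w (z + t *\<^sub>R axis i 1)) has_real_derivative w' i (z + t *\<^sub>R axis i 1)) (at t)"
          if "\<bar>t\<bar> < \<epsilon>" for t
          using dw[OF near(1)[OF that]] by (rule has_pd_at_point_of_line)
        show "((\<lambda>t. w' i (z + t *\<^sub>R axis i 1)) has_real_derivative w'' i z) (at 0)"
          using dw'[OF z_int(1)] by (simp add: has_pd_def)
        show "w (z + 0 *\<^sub>R axis i 1) \<le> w (z + t *\<^sub>R axis i 1)" if "\<bar>t\<bar> < \<epsilon>" for t
          using z(2) near[OF that] by (simp add: inK)
      qed
      then have "(\<Sum>i\<in>UNIV. w'' i z) \<ge> 0"
        by (intro sum_nonneg)
      moreover have "(\<Sum>i\<in>UNIV. w'' i z) = (\<Sum>i\<in>UNIV. u'' i i z) - 2 * \<delta> * n"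
      proof -
        let ?s = "(norm (z - c))\<^sup>2"
        have s: "?s = (\<Sum>i\<in>UNIV. (z $ i - c $ i)\<^sup>2)"
          unfolding power2_norm_eq_inner inner_vec_def by (simp add: power2_eq_square)
        define P0 where "P0 = ?s powr (- n / 2)"
        define P1 where "P1 = ?s powr (- n / 2 - 1)"
        have P: "P1 * (\<Sum>i\<in>UNIV. (z $ i - c $ i)\<^sup>2) = P0"
          using pos[OF z_int(1)] powr_add[of ?s "- n / 2 - 1" 1]
          unfolding s[symmetric] P0_def P1_def by simp
        have "w'' i z = u'' i i z - (\<mu> * (1 - n / 2) * (- 2 * n * P1) * (z $ i - c $ i)\<^sup>2
          + (\<mu> * (1 - n / 2) * (2 * P0) + 2 * \<delta>))" for i
          unfolding w''_def P0_def[symmetric] P1_def[symmetric] by (simp add: power2_eq_square algebra_simps)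
        then have "(\<Sum>i\<in>UNIV. w'' i z) = (\<Sum>i\<in>UNIV. u'' i i z)
          - (\<mu> * (1 - n / 2) * (- 2 * n * P1) * (\<Sum>i\<in>UNIV. (z $ i - c $ i)\<^sup>2)
             + n * (\<mu> * (1 - n / 2) * (2 * P0) + 2 * \<delta>))"
          by (simp add: sum.distrib sum_subtractf n_def flip: sum_distrib_left)
        also have "\<mu> * (1 - n / 2) * (- 2 * n * P1) * (\<Sum>i\<in>UNIV. (z $ i - c $ i)\<^sup>2)
          = \<mu> * (1 - n / 2) * (- 2 * n * P0)"
          unfolding P[symmetric] by (simp only: mult.assoc)
        finally show ?thesis by (simp add: algebra_simps)
      qed
      moreover have "n > 0" unfolding n_def by simp
      ultimately show False
        using superharmonic[of z] \<open>\<delta> > 0\<close> by (smt (verit) mult_pos_pos)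
    qed
    then have "w x \<ge> 0"
      using z(2)[OF \<open>x \<in> K\<close>] by linarith
    then show ?thesis
      by (simp add: w_def hR_def)
  qed
  have "((\<lambda>\<delta>. \<mu> * (h x - (R\<^sup>2) powr (1 - n / 2)) - \<delta> * (R\<^sup>2 - (norm (x - c))\<^sup>2)) \<longlongrightarrow>
      \<mu> * (h x - (R\<^sup>2) powr (1 - n / 2)) - 0 * (R\<^sup>2 - (norm (x - c))\<^sup>2)) (at_right 0)"
    by (intro tendsto_intros)
  then have "\<mu> * (h x - (R\<^sup>2) powr (1 - n / 2)) - 0 * (R\<^sup>2 - (norm (x - c))\<^sup>2) \<le> u x"
    by (rule tendsto_upperbound)
      (use ge in \<open>auto simp: eventually_at_right_less eventually_at_topological intro!: eventually_mono[OF eventually_at_right_less]\<close>)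
  then show ?thesis by simp
qed

text \<open>Let the outer radius of the annulus tend to infinity. This contains the strong minimum principle,
and its rate of decay is the one that the critical exponent requires.\<close>

lemma superharmonic_lower_bound:
  fixes u :: "real ^ 'n::finite \<Rightarrow> real"
  assumes pd: "\<And>i x. has_pd i u x (u' i x)"
    and pd2: "\<And>i j x. has_pd i (u' j) x (u'' i j x)"
    and cont: "continuous_on UNIV u"
    and superharmonic: "\<And>x. (\<Sum>i\<in>UNIV. u'' i i x) \<le> 0"
    and nonneg: "\<And>x. u x \<ge> 0"
    and c: "u c > 0" and n: "CARD('n) \<ge> 3"
  shows "\<exists>k>0. \<forall>x. u x \<ge> k * (1 + norm x) powr (2 - real CARD('n))"
proof -
  define e where "e = 1 - real CARD('n) / 2"
  have "e < 0" using n by (simp add: e_def)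
  have two_e: "2 - real CARD('n) = 2 * e" by (simp add: e_def)
  have sq: "(s\<^sup>2) powr e = s powr (2 * e)" if "s > 0" for s :: real
    using that by (simp add: powr_powr flip: powr_numeral)
  define m where "m = u c / 2"
  have "m > 0" using c by (simp add: m_def)
  have "isCont u c"
    using cont by (simp add: continuous_on_eq_continuous_at)
  then obtain d where d: "d > 0" "\<And>x. dist x c < d \<Longrightarrow> dist (u x) (u c) < m"
    using \<open>m > 0\<close> unfolding continuous_at_eps_delta by blast
  define r where "r = d / 2"
  have "r > 0" using d by (simp add: r_def)
  have ball: "u x \<ge> m" if "norm (x - c) \<le> r" for x
    using d(2)[of x] that d(1) unfolding r_def m_def dist_norm real_norm_def by (smt (verit) field_sum_of_halves)
  define \<mu> where "\<mu> = m / (r\<^sup>2) powr e"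
  have "\<mu> > 0" using \<open>m > 0\<close> \<open>r > 0\<close> by (simp add: \<mu>_def)
  have outside: "u x \<ge> \<mu> * (norm (x - c)) powr (2 * e)" if "norm (x - c) \<ge> r" for x
  proof -
    have "eventually (\<lambda>R. \<mu> * (((norm (x - c))\<^sup>2) powr e - (R\<^sup>2) powr e) \<le> u x) at_top"
      using eventually_ge_at_top[of "norm (x - c)"]
    proof eventually_elim
      case (elim R)
      show ?case
        unfolding e_def
      proof (rule superharmonic_ge_on_annulus[OF pd pd2 cont superharmonic nonneg \<open>0 < r\<close>])
        show "r \<le> R" using elim that by linarith
        show "\<mu> * (r\<^sup>2) powr (1 - real CARD('n) / 2) \<le> u y" if "norm (y - c) = r" for y
          using ball[of y] that \<open>r > 0\<close> by (simp add: \<mu>_def e_def)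
      qed (use that elim \<open>\<mu> > 0\<close> in auto)
    qed
    moreover have "((\<lambda>R. \<mu> * (((norm (x - c))\<^sup>2) powr e - (R\<^sup>2) powr e)) \<longlongrightarrow> \<mu> * (((norm (x - c))\<^sup>2) powr e - 0)) at_top"
    proof (intro tendsto_intros)
      show "((\<lambda>R. (R\<^sup>2) powr e) \<longlongrightarrow> 0) at_top"
        by (rule tendsto_neg_powr[OF \<open>e < 0\<close>])
          (simp add: filterlim_pow_at_top filterlim_ident)
    qed
    ultimately have "\<mu> * (((norm (x - c))\<^sup>2) powr e - 0) \<le> u x"
      by (intro tendsto_upperbound) auto
    then show ?thesis
      using sq[of "norm (x - c)"] that \<open>r > 0\<close> by (cases "x = c") auto
  qed
  define k where "k = min m (\<mu> * (1 + norm c) powr (2 * e))"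
  have "k > 0"
  proof -
    have "1 + norm c > 0" using norm_ge_zero[of c] by linarith
    then show ?thesis using \<open>m > 0\<close> \<open>\<mu> > 0\<close> by (simp add: k_def)
  qed
  moreover have "u x \<ge> k * (1 + norm x) powr (2 * e)" for x
  proof (cases "norm (x - c) \<le> r")
    case True
    have "(1 + norm x) powr (2 * e) \<le> 1 powr (2 * e)"
      using \<open>e < 0\<close> norm_ge_zero[of x] by (intro powr_mono2') linarith+
    then have le1: "(1 + norm x) powr (2 * e) \<le> 1" by simp
    have "k * (1 + norm x) powr (2 * e) \<le> m * 1"
      using \<open>k > 0\<close> \<open>m > 0\<close> by (intro mult_mono le1) (auto simp: k_def)
    then show ?thesis using ball[OF True] by simp
  next
    case False
    have "norm (x - c) \<le> norm x + norm c"
      by (rule norm_triangle_ineq4)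
    also have "\<dots> \<le> (1 + norm c) * (1 + norm x)"
      by (simp add: algebra_simps)
    finally have "((1 + norm c) * (1 + norm x)) powr (2 * e) \<le> (norm (x - c)) powr (2 * e)"
      using \<open>e < 0\<close> False \<open>r > 0\<close> by (intro powr_mono2') auto
    then have "\<mu> * ((1 + norm c) powr (2 * e) * (1 + norm x) powr (2 * e)) \<le> \<mu> * (norm (x - c)) powr (2 * e)"
      using \<open>\<mu> > 0\<close> by (simp add: powr_mult)
    moreover have "k * (1 + norm x) powr (2 * e) \<le> \<mu> * (1 + norm c) powr (2 * e) * (1 + norm x) powr (2 * e)"
      by (intro mult_right_mono) (auto simp: k_def)
    ultimately show ?thesis
      using outside[of x] False by (simp add: mult.assoc)
  qed
  ultimately show ?thesis
    unfolding two_e by (intro exI[of _ k]) simp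
qed

section \<open>The pointwise estimate\<close>

lemma norm_vec_sq: "(norm (x :: real ^ 'n::finite))\<^sup>2 = (\<Sum>i\<in>UNIV. (x $ i)\<^sup>2)"
  unfolding power2_norm_eq_inner inner_vec_def by (simp add: power2_eq_square)

lemma norm_mat_sq: "(norm (A :: real ^ 'n::finite ^ 'n))\<^sup>2 = (\<Sum>i\<in>UNIV. \<Sum>j\<in>UNIV. (A $ i $ j)\<^sup>2)"
  unfolding power2_norm_eq_inner inner_vec_def by (simp add: power2_eq_square)

lemma norm_matrix_vector_le: "norm (A *v x) \<le> norm A * norm (x :: real ^ 'n::finite)"
  for A :: "real ^ 'n ^ 'n"
proof -
  have "(norm (A *v x))\<^sup>2 = (\<Sum>i\<in>UNIV. (A $ i \<bullet> x)\<^sup>2)"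
    by (simp add: norm_vec_sq matrix_vector_mul_component)
  also have "\<dots> \<le> (\<Sum>i\<in>UNIV. (A $ i \<bullet> A $ i) * (x \<bullet> x))"
    by (intro sum_mono Cauchy_Schwarz_ineq)
  also have "\<dots> = (norm A * norm x)\<^sup>2"
    by (simp add: power_mult_distrib power2_norm_eq_inner inner_vec_def[of A A] sum_distrib_right)
  finally show ?thesis
    by (rule power2_le_imp_le) simp
qed

text \<open>Cauchy--Schwarz against the trace-free part \<open>B\<close> of \<open>\<xi> \<otimes> \<xi>\<close>, whose square length is
\<open>(n - 1)/n |\<xi>|\<^sup>4\<close>. The gain of the factor \<open>(n - 1)/n\<close> over the trivial bound is what lets the
argument reach dimension six.\<close>

lemma trace_free_quadratic_form_le:
  fixes E :: "real ^ 'n::finite ^ 'n" and \<xi> :: "real ^ 'n"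
  assumes "trace E = 0"
  shows "(\<xi> \<bullet> (E *v \<xi>))\<^sup>2 \<le> (real CARD('n) - 1) / real CARD('n) * (norm E)\<^sup>2 * ((norm \<xi>)\<^sup>2)\<^sup>2"
proof -
  let ?n = "real CARD('n)" and ?g = "(norm \<xi>)\<^sup>2"
  define B :: "real ^ 'n ^ 'n" where "B = (\<chi> i j. \<xi> $ i * \<xi> $ j - (if i = j then ?g / ?n else 0))"
  have n: "?n > 0" by simp
  have "E \<bullet> B = (\<Sum>i\<in>UNIV. \<Sum>j\<in>UNIV. \<xi> $ i * E $ i $ j * \<xi> $ j - (if i = j then ?g / ?n * E $ i $ i else 0))"
    unfolding inner_vec_def B_def by (intro sum.cong refl) (auto simp: algebra_simps)
  also have "\<dots> = (\<Sum>i\<in>UNIV. \<Sum>j\<in>UNIV. \<xi> $ i * E $ i $ j * \<xi> $ j) - ?g / ?n * trace E"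
    by (simp add: sum_subtractf trace_def sum_distrib_left)
  also have "(\<Sum>i\<in>UNIV. \<Sum>j\<in>UNIV. \<xi> $ i * E $ i $ j * \<xi> $ j) = \<xi> \<bullet> (E *v \<xi>)"
    by (simp add: inner_vec_def matrix_vector_mult_def sum_distrib_left mult.assoc)
  finally have EB: "E \<bullet> B = \<xi> \<bullet> (E *v \<xi>)"
    using assms by simp
  define K where "K = 2 * ?g / ?n"
  define J where "J = (?g / ?n)\<^sup>2"
  have "B \<bullet> B = (\<Sum>i\<in>UNIV. \<Sum>j\<in>UNIV. (\<xi> $ i)\<^sup>2 * (\<xi> $ j)\<^sup>2 - (if i = j then K * (\<xi> $ i)\<^sup>2 - J else 0))"
    unfolding inner_vec_def B_def K_def J_def
    by (intro sum.cong refl) (auto simp: power2_eq_square algebra_simps)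
  also have "\<dots> = (\<Sum>i\<in>UNIV. (\<xi> $ i)\<^sup>2) * (\<Sum>i\<in>UNIV. (\<xi> $ i)\<^sup>2) - (K * (\<Sum>i\<in>UNIV. (\<xi> $ i)\<^sup>2) - ?n * J)"
    by (simp add: sum_subtractf sum_product flip: sum_distrib_left)
  also have "\<dots> = (?n - 1) / ?n * ?g\<^sup>2"
    using n unfolding norm_vec_sq[symmetric] K_def J_def by (simp add: field_simps power2_eq_square)
  finally have BB: "B \<bullet> B = (?n - 1) / ?n * ?g\<^sup>2" .
  have "(E \<bullet> B)\<^sup>2 \<le> (E \<bullet> E) * (B \<bullet> B)"
    by (rule Cauchy_Schwarz_ineq)
  then show ?thesis
    unfolding EB BB by (simp add: power2_norm_eq_inner mult_ac)
qed

text \<open>Here \<open>A\<close> stands for a Hessian, \<open>\<xi>\<close> for a gradient, and \<open>l\<close> is the multiple of the identity that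
makes \<open>E\<close> trace-free.\<close>

lemma norm_sq_conformal_hessian:
  fixes A :: "real ^ 'n::finite ^ 'n" and \<xi> :: "real ^ 'n"
  assumes E: "E = (\<chi> i j. A $ i $ j - a * \<xi> $ i * \<xi> $ j + (if i = j then l else 0))"
    and l: "l * real CARD('n) = a * (norm \<xi>)\<^sup>2 - trace A"
  shows "trace E = 0" (is ?tr)
    and "E *v \<xi> = A *v \<xi> - (a * (norm \<xi>)\<^sup>2 - l) *\<^sub>R \<xi>" (is ?app)
    and "(norm A)\<^sup>2 = (norm E)\<^sup>2 + 2 * a * (\<xi> \<bullet> (E *v \<xi>)) + a\<^sup>2 * ((norm \<xi>)\<^sup>2)\<^sup>2
      - 2 * a * l * (norm \<xi>)\<^sup>2 + l\<^sup>2 * real CARD('n)" (is ?sq)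
proof -
  let ?g = "(norm \<xi>)\<^sup>2"
  have g: "(\<Sum>i\<in>UNIV. \<xi> $ i * \<xi> $ i) = ?g"
    unfolding norm_vec_sq by (simp add: power2_eq_square)
  have "trace E = trace A - a * (\<Sum>i\<in>UNIV. \<xi> $ i * \<xi> $ i) + l * real CARD('n)"
    by (simp add: E trace_def sum.distrib sum_subtractf sum_distrib_left mult.assoc)
  then show ?tr using g l by simp
  show ?app
    unfolding vec_eq_iff
  proof
    fix i
    have "(E *v \<xi>) $ i = (\<Sum>j\<in>UNIV. A $ i $ j * \<xi> $ j - a * \<xi> $ i * (\<xi> $ j * \<xi> $ j) + (if i = j then l * \<xi> $ i else 0))"
      unfolding E matrix_vector_mult_def by (simp add: algebra_simps) (intro sum.cong refl, auto simp: algebra_simps)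
    also have "\<dots> = (A *v \<xi>) $ i - a * \<xi> $ i * ?g + l * \<xi> $ i"
      unfolding g[symmetric] by (simp add: matrix_vector_mult_def sum.distrib sum_subtractf sum_distrib_left)
    finally show "(E *v \<xi>) $ i = (A *v \<xi> - (a * ?g - l) *\<^sub>R \<xi>) $ i"
      by (simp add: algebra_simps)
  qed
  have "(norm A)\<^sup>2 = (\<Sum>i\<in>UNIV. \<Sum>j\<in>UNIV. (E $ i $ j + (a * \<xi> $ i * \<xi> $ j - (if i = j then l else 0)))\<^sup>2)"
    unfolding norm_mat_sq E by (intro sum.cong refl) auto
  also have "\<dots> = (\<Sum>i\<in>UNIV. \<Sum>j\<in>UNIV. (E $ i $ j)\<^sup>2 + 2 * a * (\<xi> $ i * (E $ i $ j * \<xi> $ j)) + a\<^sup>2 * ((\<xi> $ i)\<^sup>2 * (\<xi> $ j)\<^sup>2)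
      + (if i = j then - 2 * l * E $ i $ i - 2 * a * l * (\<xi> $ i * \<xi> $ i) + l\<^sup>2 else 0))"
    by (intro sum.cong refl) (auto simp: power2_eq_square algebra_simps)
  also have "\<dots> = (norm E)\<^sup>2 + 2 * a * (\<xi> \<bullet> (E *v \<xi>)) + a\<^sup>2 * ?g\<^sup>2
      - 2 * l * trace E - 2 * a * l * ?g + l\<^sup>2 * real CARD('n)"
  proof -
    have "?g\<^sup>2 = (\<Sum>i\<in>UNIV. \<Sum>j\<in>UNIV. (\<xi> $ i)\<^sup>2 * (\<xi> $ j)\<^sup>2)"
      by (simp add: norm_vec_sq power2_eq_square[of "sum _ _"] sum_product)
    moreover have "\<xi> \<bullet> (E *v \<xi>) = (\<Sum>i\<in>UNIV. \<Sum>j\<in>UNIV. \<xi> $ i * (E $ i $ j * \<xi> $ j))"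
      by (simp add: inner_vec_def matrix_vector_mult_def sum_distrib_left)
    ultimately show ?thesis
      by (simp add: norm_mat_sq trace_def sum.distrib sum_subtractf sum_negf flip: sum_distrib_left g)
  qed
  finally show ?sq using \<open>?tr\<close> by simp
qed

text \<open>The pointwise divergence identity, divided by \<open>v\<^sup>\<alpha>\<close>, as an identity between scalars. The
letters stand for \<open>x = |\<nabla>v|\<^sup>2/v\<close>, \<open>y = v\<^sup>p\<close>, \<open>G = |\<nabla>v|\<^sup>q\<close>,
\<open>f = -\<Delta>v\<close>, \<open>A2 = |D\<^sup>2v|\<^sup>2\<close>, \<open>E2 = |E|\<^sup>2\<close>, and \<open>\<sigma>\<close> and \<open>e\<close> are the values of \<open>D\<^sup>2v\<close> and \<open>E\<close> in
the direction of the gradient. The values of \<open>a\<close> and \<open>\<alpha>\<close> are the ones for which the terms in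
\<open>x\<^sup>2\<close> and \<open>x e\<close> cancel; the remaining freedom is the parameter \<open>s\<close>.\<close>

lemma obata_identity:
  fixes N :: real
  assumes N: "N > 2"
    and a: "a = N / (N - 2)" and b: "b = (N - 1) / (N - 2)" and \<alpha>: "\<alpha> = - 2 / (N - 2)" and \<kappa>: "\<kappa> = (N - 1) / N"
    and \<tau>: "\<tau> = M * (1 / N - s * \<kappa>)" and f: "f = y + M * G"
    and A2: "A2 = E2 + 2 * a * x * e + \<kappa> * a\<^sup>2 * x\<^sup>2 + f\<^sup>2 / N"
    and \<sigma>: "\<sigma> = e + b * x - f / N"
  shows "A2 - p * y * x - M * q * G * \<sigma> + \<alpha> * x * \<sigma>
      + (\<alpha> * x * (- b * x + y / N + \<tau> * G) - b * (2 * x * \<sigma> - x\<^sup>2) + p * y * x / N + \<tau> * q * G * \<sigma>)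
      - f * (- b * x + y / N + \<tau> * G)
    = E2 + \<kappa> * (((N + 2) / (N - 2) - p) * y * x
        + M * G * ((N + 2 - q * (N - 1) - s * (q * (N - 1) - 2)) / (N - 2) * x - q * (1 + s) * e
            + (q / N + s * (1 + q / N)) * f))"
proof -
  define k where "k = 1 / (N - 2)"
  define j where "j = 1 / N"
  have k: "k * (N - 2) = 1" and j: "j * N = 1" using N by (auto simp: k_def j_def)
  have *: "a = N * k" "b = (N - 1) * k" "\<alpha> = - 2 * k" "\<kappa> = (N - 1) * j"
    by (simp_all add: a b \<alpha> \<kappa> k_def j_def)
  show ?thesis
    unfolding A2 \<sigma> \<tau> f divide_inverse * unfolding inverse_eq_divide k_def[symmetric] j_def[symmetric]
    using k j by algebra
qed

text \<open>For this \<open>q\<close> the weighted geometric mean of \<open>g\<^sup>2/u\<close> and \<open>u\<^sup>p\<close> with weights \<open>p/(p+1)\<close> and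
\<open>1/(p+1)\<close> is \<open>g\<^sup>q\<close>: the powers of \<open>u\<close> cancel.\<close>

lemma gradient_power_le:
  fixes g u p q :: real
  assumes "g \<ge> 0" "u > 0" "p > 1" "q = 2 * p / (p + 1)"
  shows "g powr q \<le> g\<^sup>2 / u + u powr p"
proof (cases "g powr (2 / (p + 1)) \<le> u")
  case True
  have "g powr q = (g powr (2 / (p + 1))) powr p"
    using assms by (simp add: powr_powr)
  also have "\<dots> \<le> u powr p"
    using True assms by (intro powr_mono2) auto
  finally show ?thesis using assms by (simp add: add_increasing)
next
  case False
  then have "g \<noteq> 0" using assms by auto
  then have g: "g > 0" using assms by simp
  have "q = 2 - 2 / (p + 1)" using assms by (simp add: field_simps)
  then have "g powr q = g\<^sup>2 / g powr (2 / (p + 1))"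
    using g by (simp add: powr_diff)
  also have "\<dots> \<le> g\<^sup>2 / u"
    using False assms g by (intro divide_left_mono) auto
  finally show ?thesis by (simp add: add_increasing2)
qed

lemma quadratic_absorption:
  fixes \<kappa> \<theta> :: real
  assumes "\<kappa> > 0" "\<theta> > 0" "e\<^sup>2 \<le> \<kappa> * E2"
  shows "\<theta> * E2 - \<kappa> * B * G * e \<ge> - (\<kappa> ^ 3 * B\<^sup>2 / (4 * \<theta>)) * G\<^sup>2"
proof -
  have "0 \<le> (\<theta> * e - \<kappa>\<^sup>2 * B * G / 2)\<^sup>2 / (\<kappa> * \<theta>)"
    using assms by simp
  also have "\<dots> = \<theta> * (e\<^sup>2 / \<kappa>) - \<kappa> * B * G * e + \<kappa> ^ 3 * B\<^sup>2 / (4 * \<theta>) * G\<^sup>2"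
    using assms by (simp add: field_simps power2_eq_square power3_eq_cube)
  also have "\<theta> * (e\<^sup>2 / \<kappa>) \<le> \<theta> * E2"
    using assms by (intro mult_left_mono) (auto simp: field_simps)
  finally show ?thesis by simp
qed

text \<open>The right-hand side of \<open>obata_identity\<close> dominates \<open>c (E2 + G\<^sup>2)\<close>. The alternative in the last premise
reflects that \<open>e\<close> is meaningful only where the gradient does not vanish.\<close>

definition coercive :: "real \<Rightarrow> real \<Rightarrow> real \<Rightarrow> real \<Rightarrow> real \<Rightarrow> real \<Rightarrow> bool" where
  "coercive N p q M s c \<longleftrightarrow> (\<forall>E2 e x y G. E2 \<ge> 0 \<longrightarrow> x \<ge> 0 \<longrightarrow> y \<ge> 0 \<longrightarrow> G \<ge> 0 \<longrightarrow> G \<le> x + y \<longrightarrow>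
    (G = 0 \<or> e\<^sup>2 \<le> (N - 1) / N * E2) \<longrightarrow>
    c * (E2 + G\<^sup>2) \<le> E2 + (N - 1) / N * (((N + 2) / (N - 2) - p) * y * x
        + M * G * ((N + 2 - q * (N - 1) - s * (q * (N - 1) - 2)) / (N - 2) * x - q * (1 + s) * e
            + (q / N + s * (1 + q / N)) * (y + M * G))))"

lemma exponent_bounds:
  fixes N p q :: real
  assumes "N \<ge> 3" "1 < p" "p \<le> (N + 2) / (N - 2)" "q = 2 * p / (p + 1)"
  shows "1 < q" "q \<le> (N + 2) / N"
proof -
  show "1 < q" using assms(2) unfolding assms(4) by (simp add: less_divide_eq)
  have "p * (N - 2) \<le> N + 2" using assms by (simp add: field_simps)
  then show "q \<le> (N + 2) / N" using assms(1,2) unfolding assms(4) by (simp add: field_simps)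
qed

text \<open>With \<open>s = 0\<close> the coefficients of \<open>M G x\<close> and \<open>M G y\<close> are positive. Since \<open>G \<le> x + y\<close>, these two
terms control a fixed multiple of \<open>M G\<^sup>2\<close>, which beats the loss of order \<open>M\<^sup>2 G\<^sup>2\<close> for small \<open>M\<close>.\<close>

lemma coercive_small_M:
  fixes N p q :: real
  assumes N: "N \<ge> 3" and p: "1 < p" "p \<le> (N + 2) / (N - 2)" and q: "q = 2 * p / (p + 1)"
  shows "\<exists>M1>0. \<forall>M. 0 < M \<longrightarrow> M < M1 \<longrightarrow> (\<exists>c>0. coercive N p q M 0 c)"
proof -
  note qb = exponent_bounds[OF N p q]
  define \<kappa> where "\<kappa> = (N - 1) / N"
  have \<kappa>: "0 < \<kappa>" "\<kappa> \<le> 1" using N by (auto simp: \<kappa>_def field_simps)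
  define c1 where "c1 = (N + 2 - q * (N - 1)) / (N - 2)"
  have "q * (N - 1) \<le> (N + 2) / N * (N - 1)" using qb N by (intro mult_right_mono) auto
  also have "\<dots> < N + 2" using N by (simp add: field_simps)
  finally have c1: "c1 > 0" using N by (simp add: c1_def)
  define m where "m = min c1 (q / N)"
  have m: "m > 0" "m \<le> c1" "m \<le> q / N" using c1 qb N by (auto simp: m_def)
  have "\<exists>c>0. coercive N p q M 0 c" if M: "0 < M" "M < m / q\<^sup>2" for M
  proof -
    define d where "d = \<kappa> * M * (m - \<kappa>\<^sup>2 * M * q\<^sup>2 / 2)"
    have Mq: "M * q\<^sup>2 < m" using M qb by (simp add: field_simps)
    have "\<kappa>\<^sup>2 * (M * q\<^sup>2) \<le> 1 * (M * q\<^sup>2)"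
      using \<kappa> M by (intro mult_right_mono) (auto simp: power_le_one)
    then have "m - \<kappa>\<^sup>2 * M * q\<^sup>2 / 2 > 0" using Mq m by simp
    then have d: "d > 0" using \<kappa> M by (simp add: d_def)
    have "coercive N p q M 0 (min (1 / 2) d)"
      unfolding coercive_def \<kappa>_def[symmetric]
    proof (intro allI impI)
      fix E2 e x y G :: real
      assume *: "0 \<le> E2" "0 \<le> x" "0 \<le> y" "0 \<le> G" "G \<le> x + y" "G = 0 \<or> e\<^sup>2 \<le> \<kappa> * E2"
      have q1: "\<kappa> * (((N + 2) / (N - 2) - p) * y * x) \<ge> 0"
        using p * \<kappa> by simp
      have q2: "1 / 2 * E2 - \<kappa> * (M * q) * G * e \<ge> - (\<kappa> ^ 3 * (M * q)\<^sup>2 / 2) * G\<^sup>2"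
        using *(6)
      proof
        assume "G = 0" then show ?thesis using * by simp
      next
        assume "e\<^sup>2 \<le> \<kappa> * E2"
        from quadratic_absorption[OF \<kappa>(1) _ this, of "1 / 2" "M * q" G] show ?thesis by simp
      qed
      have "m * G \<le> m * x + m * y" using * m by (simp flip: distrib_left)
      also have "\<dots> \<le> c1 * x + q / N * y" using * m by (intro add_mono mult_right_mono) auto
      also have "\<dots> \<le> c1 * x + q / N * (y + M * G)"
        using * M qb N c1 by (intro add_mono mult_left_mono) auto
      finally have "\<kappa> * M * G * (c1 * x + q / N * (y + M * G)) \<ge> \<kappa> * M * G * (m * G)"
        using * \<kappa> M by (intro mult_left_mono) auto
      then have "E2 / 2 + d * G\<^sup>2 \<le> E2 + \<kappa> * (((N + 2) / (N - 2) - p) * y * x + M * G * (c1 * x - q * e + q / N * (y + M * G)))"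
        using q1 q2 by (simp add: d_def algebra_simps power2_eq_square power3_eq_cube)
      moreover have "min (1 / 2) d * (E2 + G\<^sup>2) \<le> E2 / 2 + d * G\<^sup>2"
        using mult_right_mono[OF min.cobounded1[of "1 / 2" d] *(1)]
          mult_right_mono[OF min.cobounded2[of "1 / 2" d] zero_le_power2[of G]]
        by (simp add: distrib_left)
      ultimately show "min (1 / 2) d * (E2 + G\<^sup>2) \<le> E2 + \<kappa> * (((N + 2) / (N - 2) - p) * y * x
        + M * G * ((N + 2 - q * (N - 1) - 0 * (q * (N - 1) - 2)) / (N - 2) * x - q * (1 + 0) * e
            + (q / N + 0 * (1 + q / N)) * (y + M * G)))"
        by (simp add: c1_def)
    qed
    then show ?thesis using d by (intro exI[of _ "min (1/2) d"]) auto
  qed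
  then show ?thesis
    using m qb by (intro exI[of _ "m / q\<^sup>2"]) auto
qed

text \<open>Loss and gain are now both of order \<open>M\<^sup>2 G\<^sup>2\<close>, so their comparison does not involve \<open>M\<close>. Increasing
\<open>s\<close> raises the gain \<open>c2\<close>, but it also raises the loss and lowers the coefficient \<open>c1\<close> of \<open>M G x\<close>;
the value \<open>1/4\<close> keeps \<open>c1 \<ge> 0\<close> and makes the discriminant condition strict in all dimensions from three to six.\<close>

lemma coercive_low_dimension:
  fixes p q :: real and n :: nat
  assumes n: "3 \<le> n" "n \<le> 6" and p: "1 < p" "p \<le> (real n + 2) / (real n - 2)" and q: "q = 2 * p / (p + 1)"
    and M: "M > 0"
  shows "\<exists>c>0. coercive n p q M (1 / 4) c"
proof -
  define N where "N = real n"
  have N: "N \<ge> 3" using n by (simp add: N_def)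
  note qb = exponent_bounds[OF N p[folded N_def] q]
  define \<kappa> where "\<kappa> = (N - 1) / N"
  have \<kappa>: "0 < \<kappa>" "\<kappa> \<le> 1" using N by (auto simp: \<kappa>_def field_simps)
  define c1 where "c1 = (N + 2 - q * (N - 1) - 1 / 4 * (q * (N - 1) - 2)) / (N - 2)"
  define c2 where "c2 = q / N + 1 / 4 * (1 + q / N)"
  have "n = 3 \<or> n = 4 \<or> n = 5 \<or> n = 6" using n by auto
  then have "c1 \<ge> 0 \<and> (\<kappa> * q * (1 + 1 / 4))\<^sup>2 < 4 * c2"
  proof -
    \<comment> \<open>Replacing one factor \<open>q\<close> by its upper bound makes the condition linear in \<open>q\<close>.\<close>
    have "q * q \<le> (N + 2) / N * q"
      using qb by (intro mult_right_mono) auto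
    then have q2: "\<kappa>\<^sup>2 * (q * q) \<le> \<kappa>\<^sup>2 * ((N + 2) / N * q)"
      by (rule mult_left_mono) simp
    have "(\<kappa> * q * (1 + 1 / 4))\<^sup>2 = 25 / 16 * (\<kappa>\<^sup>2 * (q * q))"
      by (simp add: power2_eq_square)
    also have "\<dots> \<le> 25 / 16 * (\<kappa>\<^sup>2 * ((N + 2) / N * q))"
      using q2 by (rule mult_left_mono) simp
    finally have disc: "(\<kappa> * q * (1 + 1 / 4))\<^sup>2 \<le> 25 / 16 * (\<kappa>\<^sup>2 * ((N + 2) / N * q))" .
    have "25 / 16 * (\<kappa>\<^sup>2 * ((N + 2) / N * q)) < 4 * c2"
      using \<open>n = 3 \<or> n = 4 \<or> n = 5 \<or> n = 6\<close> qb
      by (elim disjE) (auto simp: c2_def \<kappa>_def N_def power2_eq_square field_simps)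
    moreover have "c1 \<ge> 0"
      using \<open>n = 3 \<or> n = 4 \<or> n = 5 \<or> n = 6\<close> qb
      by (elim disjE) (simp_all add: c1_def N_def)
    ultimately show ?thesis using disc by linarith
  qed
  then have c1: "c1 \<ge> 0" and disc: "(\<kappa> * q * (1 + 1 / 4))\<^sup>2 < 4 * c2" by auto
  have c2: "c2 > 0" using qb N by (simp add: c2_def add_pos_pos)
  \<comment> \<open>The share \<open>\<theta>\<close> of \<open>E2\<close> absorbs the cross term, the share \<open>1 - \<theta>\<close> survives.\<close>
  obtain \<theta> where \<theta>: "(\<kappa> * q * (1 + 1 / 4))\<^sup>2 / (4 * c2) < \<theta>" "\<theta> < 1"
    using dense[of "(\<kappa> * q * (1 + 1 / 4))\<^sup>2 / (4 * c2)" 1] disc c2 by (auto simp: field_simps)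
  then have \<theta>0: "\<theta> > 0" using c2 by (smt (verit) divide_nonneg_pos zero_le_power2)
  define B where "B = M * q * (1 + 1 / 4)"
  define d where "d = \<kappa> * M\<^sup>2 * c2 - \<kappa> ^ 3 * B\<^sup>2 / (4 * \<theta>)"
  have d: "d > 0"
  proof -
    have "(\<kappa> * q * (1 + 1 / 4))\<^sup>2 < 4 * c2 * \<theta>"
      using \<theta>(1) c2 by (simp add: field_simps)
    then have "\<kappa> * M\<^sup>2 * (\<kappa> * q * (1 + 1 / 4))\<^sup>2 < \<kappa> * M\<^sup>2 * (4 * c2 * \<theta>)"
      using \<kappa> M by (intro mult_strict_left_mono) auto
    then show ?thesis
      using \<theta>0 by (simp add: d_def B_def field_simps power2_eq_square power3_eq_cube)
  qed
  have "coercive N p q M (1 / 4) (min (1 - \<theta>) d)"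
    unfolding coercive_def \<kappa>_def[symmetric] c1_def[symmetric] c2_def[symmetric]
  proof (intro allI impI)
    fix E2 e x y G :: real
    assume *: "0 \<le> E2" "0 \<le> x" "0 \<le> y" "0 \<le> G" "G \<le> x + y" "G = 0 \<or> e\<^sup>2 \<le> \<kappa> * E2"
    have q1: "\<kappa> * (((N + 2) / (N - 2) - p) * y * x) \<ge> 0"
      using p * \<kappa> by (simp add: N_def)
    have q2: "\<theta> * E2 - \<kappa> * B * G * e \<ge> - (\<kappa> ^ 3 * B\<^sup>2 / (4 * \<theta>)) * G\<^sup>2"
      using *(6)
    proof
      assume "G = 0" then show ?thesis using * \<theta>0 by simp
    next
      assume "e\<^sup>2 \<le> \<kappa> * E2"
      from quadratic_absorption[OF \<kappa>(1) \<theta>0 this] show ?thesis .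
    qed
    have q3: "\<kappa> * M * G * (c1 * x) \<ge> 0" "\<kappa> * M * G * (c2 * y) \<ge> 0"
      using * \<kappa> M c1 c2 by simp_all
    have "(1 - \<theta>) * E2 + d * G\<^sup>2 \<le> E2 + \<kappa> * (((N + 2) / (N - 2) - p) * y * x + M * G * (c1 * x - q * (1 + 1 / 4) * e + c2 * (y + M * G)))"
      using q1 q2 q3 by (simp add: d_def B_def algebra_simps power2_eq_square)
    moreover have "min (1 - \<theta>) d * (E2 + G\<^sup>2) \<le> (1 - \<theta>) * E2 + d * G\<^sup>2"
      using mult_right_mono[OF min.cobounded1[of "1 - \<theta>" d] *(1)]
        mult_right_mono[OF min.cobounded2[of "1 - \<theta>" d] zero_le_power2[of G]]
      by (simp add: distrib_left)
    ultimately show "min (1 - \<theta>) d * (E2 + G\<^sup>2) \<le> E2 + \<kappa> * (((N + 2) / (N - 2) - p) * y * x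
        + M * G * (c1 * x - q * (1 + 1 / 4) * e + c2 * (y + M * G)))"
      by simp
  qed
  then show ?thesis using d \<theta> unfolding N_def by (intro exI[of _ "min (1 - \<theta>) d"]) auto
qed

section \<open>Powers of the length of the gradient\<close>

lemma continuous_norm_powr_scaleR:
  fixes r :: real
  assumes "r > 1"
  shows "continuous_on UNIV (\<lambda>\<xi> :: 'a::real_normed_vector. norm \<xi> powr (r - 2) *\<^sub>R \<xi>)"
proof -
  have "isCont (\<lambda>\<xi> :: 'a. norm \<xi> powr (r - 2) *\<^sub>R \<xi>) \<xi>" for \<xi>
  proof (cases "\<xi> = 0")
    case False
    then show ?thesis by (intro continuous_intros) auto
  next
    case True
    have eq: "norm (norm \<eta> powr (r - 2) *\<^sub>R \<eta>) = norm \<eta> powr (r - 1)" for \<eta> :: 'a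
      by (cases "\<eta> = 0") (simp_all add: powr_mult_base mult.commute)
    have "((\<lambda>\<eta> :: 'a. norm \<eta> powr (r - 1)) \<longlongrightarrow> 0) (at 0)"
      using assms by (intro tendsto_zero_powrI[where b="r - 1"] tendsto_norm_zero tendsto_intros) auto
    then have "((\<lambda>\<eta> :: 'a. norm (norm \<eta> powr (r - 2) *\<^sub>R \<eta>)) \<longlongrightarrow> 0) (at 0)"
      by (simp only: eq)
    then have "((\<lambda>\<eta> :: 'a. norm \<eta> powr (r - 2) *\<^sub>R \<eta>) \<longlongrightarrow> 0) (at 0)"
      by (rule tendsto_norm_zero_cancel)
    then show ?thesis using True by (simp add: isCont_def)
  qed
  then show ?thesis by (simp add: continuous_at_imp_continuous_on)
qed

lemma norm_sq_powr_half: "((norm x)\<^sup>2) powr (r / 2) = norm x powr r"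
  by (cases "x = 0") (simp_all add: powr_powr flip: powr_numeral)

text \<open>Since \<open>r\<close> may be smaller than two, the chain rule through \<open>|X|\<^sup>2\<close> works only where \<open>X \<noteq> 0\<close>. At a
zero of \<open>X\<close> the function is of order \<open>|t|\<^sup>r\<close> along the line, hence has derivative zero.\<close>

lemma has_pd_norm_powr:
  fixes X :: "real ^ 'n::finite \<Rightarrow> real ^ 'n"
  assumes r: "r > 1" and X: "\<And>j. has_pd i (\<lambda>x. X x $ j) x (Y $ j)"
  shows "has_pd i (\<lambda>x. norm (X x) powr r) x (r * (norm (X x) powr (r - 2) * (X x \<bullet> Y)))"
proof (cases "X x = 0")
  case False
  have "has_pd i (\<lambda>x. \<Sum>j\<in>UNIV. X x $ j * X x $ j) x (\<Sum>j\<in>UNIV. Y $ j * X x $ j + X x $ j * Y $ j)"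
    by (intro has_pd_sum has_pd_mult X)
  then have sq: "has_pd i (\<lambda>x. (norm (X x))\<^sup>2) x (2 * (X x \<bullet> Y))"
    unfolding norm_vec_sq inner_vec_def by (simp add: power2_eq_square sum_distrib_left algebra_simps)
  have "has_pd i (\<lambda>x. ((norm (X x))\<^sup>2) powr (r / 2)) x (r / 2 * ((norm (X x))\<^sup>2) powr (r / 2 - 1) * (2 * (X x \<bullet> Y)))"
    by (rule has_pd_chain[OF _ sq]) (use False in \<open>auto intro!: derivative_eq_intros\<close>)
  moreover have "r / 2 - 1 = (r - 2) / 2" by simp
  ultimately show ?thesis
    unfolding norm_sq_powr_half by (simp only: norm_sq_powr_half) (simp add: mult.assoc)
next
  case True
  let ?l = "\<lambda>t. x + t *\<^sub>R axis i (1::real)"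
  have X0: "((\<lambda>t. X (?l t) $ j / t) \<longlongrightarrow> Y $ j) (at 0)" for j
    using X[of j] True by (simp add: has_pd_def DERIV_def)
  have comp0: "((\<lambda>t. X (?l t) $ j) \<longlongrightarrow> 0) (at 0)" for j
  proof -
    have "isCont (\<lambda>t. X (?l t) $ j) 0"
      using X[of j] unfolding has_pd_def by (rule DERIV_isCont)
    then show ?thesis using True by (simp add: isCont_def)
  qed
  have "((\<lambda>t. X (?l t)) \<longlongrightarrow> 0) (at 0)"
    by (rule vec_tendstoI) (use comp0 in simp)
  then have "((\<lambda>t. norm (X (?l t)) powr (r - 1)) \<longlongrightarrow> 0) (at 0)"
    using r by (intro tendsto_zero_powrI[where b="r - 1"] tendsto_norm_zero tendsto_intros) auto
  moreover have "((\<lambda>t. \<Sum>j\<in>UNIV. \<bar>X (?l t) $ j / t\<bar>) \<longlongrightarrow> (\<Sum>j\<in>UNIV. \<bar>Y $ j\<bar>)) (at 0)"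
    by (intro tendsto_sum tendsto_rabs X0)
  ultimately have "((\<lambda>t. (\<Sum>j\<in>UNIV. \<bar>X (?l t) $ j / t\<bar>) * norm (X (?l t)) powr (r - 1)) \<longlongrightarrow> (\<Sum>j\<in>UNIV. \<bar>Y $ j\<bar>) * 0) (at 0)"
    by (intro tendsto_mult)
  then have lim: "((\<lambda>t. (\<Sum>j\<in>UNIV. \<bar>X (?l t) $ j / t\<bar>) * norm (X (?l t)) powr (r - 1)) \<longlongrightarrow> 0) (at 0)"
    by simp
  have "norm (norm (X (?l t)) powr r / t) \<le> (\<Sum>j\<in>UNIV. \<bar>X (?l t) $ j / t\<bar>) * norm (X (?l t)) powr (r - 1)" for t
  proof -
    have "norm (X (?l t)) powr r = norm (X (?l t)) * norm (X (?l t)) powr (r - 1)"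
      by (cases "X (?l t) = 0") (simp_all add: powr_mult_base)
    then have "norm (norm (X (?l t)) powr r / t) = norm (X (?l t)) / \<bar>t\<bar> * norm (X (?l t)) powr (r - 1)"
      by (simp add: abs_mult)
    also have "norm (X (?l t)) / \<bar>t\<bar> \<le> (\<Sum>j\<in>UNIV. \<bar>X (?l t) $ j\<bar>) / \<bar>t\<bar>"
      by (intro divide_right_mono norm_le_l1_cart) auto
    also have "\<dots> = (\<Sum>j\<in>UNIV. \<bar>X (?l t) $ j / t\<bar>)"
      by (simp add: sum_divide_distrib)
    finally show ?thesis by (simp add: mult_right_mono)
  qed
  then have "((\<lambda>t. norm (X (?l t)) powr r / t) \<longlongrightarrow> 0) (at 0)"
    by (intro Lim_null_comparison[OF always_eventually lim]) auto
  then show ?thesis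
    using True by (simp add: has_pd_def DERIV_def)
qed

section \<open>The weighted Bochner identity of a positive solution\<close>

text \<open>The families \<open>u'\<close> and \<open>u''\<close> are the first and second partial derivatives, with
\<open>u'' i j = \<partial>\<^sub>i (u' j)\<close>.\<close>

locale positive_solution =
  fixes u :: "real ^ 'n::finite \<Rightarrow> real" and u' :: "'n \<Rightarrow> real ^ 'n \<Rightarrow> real"
    and u'' :: "'n \<Rightarrow> 'n \<Rightarrow> real ^ 'n \<Rightarrow> real" and n p q M :: real
  assumes n: "n = real CARD('n)" and dim: "n \<ge> 3" and p: "p > 1" and q: "q = 2 * p / (p + 1)" and M: "M > 0"
    and pd: "\<And>i x. has_pd i u x (u' i x)"
    and pd2: "\<And>i j x. has_pd i (u' j) x (u'' i j x)"
    and cont: "\<And>i j. continuous_on UNIV (u'' i j)"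
    and pos: "\<And>x. u x > 0"
    and equation: "\<And>x. (\<Sum>i\<in>UNIV. u'' i i x) = - (u x powr p + M * norm (\<chi> i. u' i x) powr q)"
begin

definition D :: "real ^ 'n \<Rightarrow> real ^ 'n" where "D x = (\<chi> i. u' i x)"
definition A :: "real ^ 'n \<Rightarrow> real ^ 'n ^ 'n" where "A x = (\<chi> i j. u'' i j x)"
definition G :: "real ^ 'n \<Rightarrow> real" where "G x = norm (D x) powr q"

definition \<alpha> :: real where "\<alpha> = - 2 / (n - 2)"

text \<open>The trace-free part of \<open>D\<^sup>2u - n/(n-2) \<nabla>u \<otimes> \<nabla>u / u\<close>; the equation has been used to express
the trace of \<open>D\<^sup>2u\<close>.\<close>

definition E :: "real ^ 'n \<Rightarrow> real ^ 'n ^ 'n" where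
  "E x = (\<chi> i j. A x $ i $ j - n / (n - 2) / u x * D x $ i * D x $ j
     + (if i = j then (u x powr p + M * G x + n / (n - 2) * (norm (D x))\<^sup>2 / u x) / n else 0))"
definition P :: "real ^ 'n \<Rightarrow> real" where "P x = (norm (E x))\<^sup>2 + (G x)\<^sup>2"

lemma q1: "q > 1" using p unfolding q by (simp add: less_divide_eq)

lemma cont_u': "continuous_on UNIV (u' i)"
  by (rule continuous_if_continuous_pd[OF pd2 cont])

lemma cont_u: "continuous_on UNIV u"
  by (rule continuous_if_continuous_pd[OF pd cont_u'])

lemma cont_D: "continuous_on UNIV D"
  unfolding D_def[abs_def] by (intro continuous_intros cont_u')

lemma cont_A: "continuous_on UNIV A"
  unfolding A_def[abs_def] by (intro continuous_intros cont)

lemma cont_u_powr: "continuous_on UNIV (\<lambda>x. u x powr r)"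
  using pos by (intro continuous_intros cont_u) (auto simp: less_imp_neq[symmetric])

lemma cont_G: "continuous_on UNIV G"
  unfolding G_def[abs_def] using q1 by (intro continuous_intros continuous_on_powr' cont_D) auto

lemma cont_E: "continuous_on UNIV E"
proof -
  have u0: "u x \<noteq> 0" for x using pos[of x] by simp
  have "continuous_on UNIV (\<lambda>x. (u x powr p + M * G x + n / (n - 2) * (norm (D x))\<^sup>2 / u x) / n)"
    using u0 dim by (intro continuous_on_add continuous_on_mult continuous_on_divide continuous_on_const
      continuous_on_power continuous_on_norm cont_u_powr cont_G cont_D cont_u) auto
  moreover have "continuous_on UNIV (\<lambda>x. A x $ i $ j - n / (n - 2) / u x * D x $ i * D x $ j)" for i j
    using u0 by (intro continuous_on_diff continuous_on_mult continuous_on_divide continuous_on_const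
      continuous_on_component cont_A cont_D cont_u) auto
  ultimately have "continuous_on UNIV (\<lambda>x. A x $ i $ j - n / (n - 2) / u x * D x $ i * D x $ j
     + (if i = j then (u x powr p + M * G x + n / (n - 2) * (norm (D x))\<^sup>2 / u x) / n else 0))" for i j
    by (cases "i = j") (auto intro!: continuous_on_add)
  then show ?thesis
    unfolding E_def[abs_def] by (intro continuous_on_vec_lambda)
qed

lemma cont_P: "continuous_on UNIV P"
  unfolding P_def[abs_def] by (intro continuous_intros cont_E cont_G)

lemma hessian_symmetric: "u'' i j x = u'' j i x"
  by (rule pd_commute[OF pd pd2 cont])

definition AD :: "real ^ 'n \<Rightarrow> real ^ 'n" where "AD x = A x *v D x"

lemma AD_nth: "AD x $ i = (\<Sum>j\<in>UNIV. u'' i j x * u' j x)"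
  by (simp add: AD_def A_def D_def matrix_vector_mult_def)

lemma has_pd_g: "has_pd i (\<lambda>x. (norm (D x))\<^sup>2) x (2 * AD x $ i)"
proof -
  have "has_pd i (\<lambda>x. \<Sum>j\<in>UNIV. u' j x * u' j x) x (\<Sum>j\<in>UNIV. u'' i j x * u' j x + u' j x * u'' i j x)"
    by (intro has_pd_sum has_pd_mult pd2)
  then show ?thesis
    unfolding norm_vec_sq by (simp add: AD_nth D_def power2_eq_square sum_distrib_left algebra_simps)
qed

definition dG :: "real ^ 'n \<Rightarrow> real ^ 'n" where "dG x = norm (D x) powr (q - 2) *\<^sub>R AD x"

lemma has_pd_G: "has_pd i G x (q * (dG x $ i))"
proof -
  have "has_pd i (\<lambda>x. norm (D x) powr q) x (q * (norm (D x) powr (q - 2) * (D x \<bullet> (\<chi> j. u'' i j x))))"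
    by (rule has_pd_norm_powr[OF q1]) (simp add: D_def pd2)
  moreover have "D x \<bullet> (\<chi> j. u'' i j x) = AD x $ i"
    by (simp add: AD_nth inner_vec_def D_def mult.commute)
  ultimately show ?thesis
    by (simp add: G_def[abs_def] dG_def)
qed

lemma cont_dG: "continuous_on UNIV dG"
proof -
  have "continuous_on UNIV (\<lambda>x. norm (D x) powr (q - 2) *\<^sub>R D x)"
    by (rule continuous_on_compose2[OF continuous_norm_powr_scaleR[OF q1] cont_D]) auto
  then have "continuous_on UNIV (\<lambda>x. \<chi> i. \<Sum>j\<in>UNIV. u'' i j x * (norm (D x) powr (q - 2) *\<^sub>R D x) $ j)"
    by (intro continuous_on_vec_lambda continuous_on_sum continuous_on_mult continuous_on_component cont)
  moreover have "(\<lambda>x. \<chi> i. \<Sum>j\<in>UNIV. u'' i j x * (norm (D x) powr (q - 2) *\<^sub>R D x) $ j) = dG"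
    by (rule ext) (simp add: vec_eq_iff dG_def AD_nth D_def sum_distrib_left sum_distrib_right mult_ac)
  ultimately show ?thesis by (rule back_subst[of "continuous_on UNIV"])
qed

lemma cont_AD: "continuous_on UNIV AD"
proof -
  have "continuous_on UNIV (\<lambda>x. \<chi> i. \<Sum>j\<in>UNIV. u'' i j x * u' j x)"
    by (intro continuous_intros cont cont_u')
  moreover have "(\<lambda>x. \<chi> i. \<Sum>j\<in>UNIV. u'' i j x * u' j x) = AD"
    by (rule ext) (simp add: vec_eq_iff AD_nth)
  ultimately show ?thesis by (rule back_subst[of "continuous_on UNIV"])
qed

lemma has_pd_u_powr: "has_pd i (\<lambda>x. u x powr r) x (r * u x powr (r - 1) * u' i x)"
  by (rule has_pd_chain[OF _ pd]) (use pos in \<open>auto intro!: derivative_eq_intros\<close>)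

lemma has_pd_laplacian:
  "has_pd j (\<lambda>x. \<Sum>i\<in>UNIV. u'' i i x) x (- (p * u x powr (p - 1) * u' j x + M * (q * (dG x $ j))))"
proof -
  have "has_pd j (\<lambda>x. (-1) * (u x powr p + M * G x)) x
      ((-1) * (p * u x powr (p - 1) * u' j x + M * (q * (dG x $ j))))"
    by (intro has_pd_cmult has_pd_add has_pd_u_powr has_pd_G)
  then show ?thesis
    by (simp add: equation G_def D_def)
qed

text \<open>The field \<open>u\<^sup>\<alpha> E \<nabla>u - s (n-1)/n M u\<^sup>\<alpha> |\<nabla>u|\<^sup>q \<nabla>u\<close> is \<open>u\<^sup>\<alpha> D\<^sup>2u \<nabla>u + H \<tau> \<nabla>u\<close> for
\<open>\<tau> = M (1/n - s (n-1)/n)\<close>. Only its first summand is not differentiable and needs the weak form of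
Bochner's formula.\<close>

definition H :: "real \<Rightarrow> real ^ 'n \<Rightarrow> real" where
  "H \<tau> x = - ((n - 1) / (n - 2)) * (u x powr (\<alpha> - 1) * (norm (D x))\<^sup>2) + (1 / n) * u x powr (\<alpha> + p)
     + \<tau> * (u x powr \<alpha> * G x)"

definition H' :: "real \<Rightarrow> 'n \<Rightarrow> real ^ 'n \<Rightarrow> real" where
  "H' \<tau> i x = - ((n - 1) / (n - 2)) * ((\<alpha> - 1) * u x powr (\<alpha> - 1 - 1) * u' i x * (norm (D x))\<^sup>2
        + u x powr (\<alpha> - 1) * (2 * AD x $ i))
     + (1 / n) * ((\<alpha> + p) * u x powr (\<alpha> + p - 1) * u' i x)
     + \<tau> * (\<alpha> * u x powr (\<alpha> - 1) * u' i x * G x + u x powr \<alpha> * (q * (dG x $ i)))"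

lemma has_pd_H: "has_pd i (H \<tau>) x (H' \<tau> i x)"
  unfolding H_def[abs_def] H'_def
  by (intro has_pd_add has_pd_cmult has_pd_mult has_pd_u_powr has_pd_g has_pd_G)

lemma cont_H: "continuous_on UNIV (H \<tau>)"
  unfolding H_def[abs_def] by (intro continuous_intros cont_u_powr cont_G cont_D)

lemma cont_H': "continuous_on UNIV (H' \<tau> i)"
  unfolding H'_def[abs_def]
  by (intro continuous_on_add continuous_on_mult continuous_on_const continuous_on_power continuous_on_norm
      continuous_on_component cont_u_powr cont_G cont_D cont_dG cont_AD cont_u')

text \<open>The weak form of the divergence of the above field, multiplied by the test function \<open>\<psi>\<close> with
gradient \<open>\<psi>'\<close>: the integrands of \<open>weak_bochner\<close> for \<open>\<phi> = u\<^sup>\<alpha> \<psi>\<close>, summed over the directions, plus the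
divergence of \<open>\<psi> (H \<tau>) \<nabla>u\<close>, with the Laplacian eliminated by the equation.\<close>

definition T :: "real \<Rightarrow> (real ^ 'n \<Rightarrow> real) \<Rightarrow> (real ^ 'n \<Rightarrow> real ^ 'n) \<Rightarrow> real ^ 'n \<Rightarrow> real" where
  "T \<tau> \<psi> \<psi>' x = - (p * u x powr (p - 1) * (norm (D x))\<^sup>2 + M * (q * (D x \<bullet> dG x))) * (u x powr \<alpha> * \<psi> x)
      + (norm (A x))\<^sup>2 * (u x powr \<alpha> * \<psi> x)
      + (\<alpha> * u x powr (\<alpha> - 1) * (D x \<bullet> AD x) * \<psi> x + u x powr \<alpha> * (AD x \<bullet> \<psi>' x))
      + H \<tau> x * (D x \<bullet> \<psi>' x) + \<psi> x * (\<Sum>i\<in>UNIV. u' i x * H' \<tau> i x)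
      - \<psi> x * H \<tau> x * (u x powr p + M * G x)"

lemma weak_identity:
  assumes \<psi>: "\<And>i x. has_pd i \<psi> x (\<psi>' x $ i)" "continuous_on UNIV \<psi>'"
    and supp: "\<And>x. norm x > R \<Longrightarrow> \<psi> x = 0"
  shows "integrable lborel (T \<tau> \<psi> \<psi>')" "integral\<^sup>L lborel (T \<tau> \<psi> \<psi>') = 0"
proof -
  define \<phi> where "\<phi> = (\<lambda>x. u x powr \<alpha> * \<psi> x)"
  define \<phi>' where "\<phi>' = (\<lambda>i x. \<alpha> * u x powr (\<alpha> - 1) * u' i x * \<psi> x + u x powr \<alpha> * \<psi>' x $ i)"
  have c\<psi>': "continuous_on UNIV (\<lambda>x. \<psi>' x $ i)" for i
    by (intro continuous_intros \<psi>)
  have c\<psi>: "continuous_on UNIV \<psi>"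
    by (rule continuous_if_continuous_pd[OF \<psi>(1) c\<psi>'])
  have \<phi>: "has_pd i \<phi> x (\<phi>' i x)" for i x
    unfolding \<phi>_def \<phi>'_def by (intro has_pd_mult has_pd_u_powr \<psi>)
  have c\<phi>': "continuous_on UNIV (\<phi>' i)" for i
    unfolding \<phi>'_def by (intro continuous_intros cont_u_powr cont_u' c\<psi> c\<psi>')
  have c\<phi>: "continuous_on UNIV \<phi>"
    unfolding \<phi>_def by (intro continuous_intros cont_u_powr c\<psi>)
  have supp\<phi>: "\<phi> x = 0" if "norm x > R" for x
    using supp[OF that] by (simp add: \<phi>_def)
  have supp\<psi>': "\<psi>' x $ i = 0" if "norm x > R" for x i
    using pd_eq_0_outside_support[OF \<psi>(1) _ that] supp by blast
  have supp\<phi>': "\<phi>' i x = 0" if "norm x > R" for x i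
    using supp supp\<psi>' that by (simp add: \<phi>'_def)
  define L' where "L' = (\<lambda>j x. - (p * u x powr (p - 1) * u' j x + M * (q * (dG x $ j))))"
  have cL': "continuous_on UNIV (L' j)" for j
    unfolding L'_def by (intro continuous_intros cont_u_powr cont_u' cont_dG)
  define T1 where "T1 = (\<lambda>j x. L' j x * (u' j x * \<phi> x) + (\<Sum>i\<in>UNIV. u'' j i x * (u'' i j x * \<phi> x + u' j x * \<phi>' i x)))"
  define T2 where "T2 = (\<lambda>i x. \<psi>' x $ i * (H \<tau> x * u' i x) + \<psi> x * (H' \<tau> i x * u' i x + H \<tau> x * u'' i i x))"
  have T1: "integrable lborel (T1 j)" "integral\<^sup>L lborel (T1 j) = 0" for j
  proof -
    show "integrable lborel (T1 j)"
      unfolding T1_def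
      by (rule integrable_continuous_support[where R=R])
        (auto intro!: continuous_intros cL' cont_u' c\<phi> cont c\<phi>' simp: supp\<phi> supp\<phi>')
    show "integral\<^sup>L lborel (T1 j) = 0"
      unfolding T1_def L'_def
      by (rule weak_bochner[OF pd pd2 cont has_pd_laplacian cL'[unfolded L'_def] \<phi> c\<phi>' supp\<phi>])
  qed
  have T2: "integrable lborel (T2 i)" "integral\<^sup>L lborel (T2 i) = 0" for i
  proof -
    have c: "continuous_on UNIV (T2 i)"
      unfolding T2_def by (intro continuous_intros c\<psi>' c\<psi> cont_H cont_H' cont_u' cont)
    then show "integrable lborel (T2 i)"
      by (rule integrable_continuous_support[where R=R]) (simp add: T2_def supp supp\<psi>')
    have "has_pd i (\<lambda>x. \<psi> x * (H \<tau> x * u' i x)) x (T2 i x)" for x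
      unfolding T2_def by (intro has_pd_mult \<psi> has_pd_H pd2)
    then show "integral\<^sup>L lborel (T2 i) = 0"
      by (rule integral_pd_eq_0[where R=R, OF _ _ c])
        (auto intro!: continuous_intros c\<psi> cont_H cont_u' simp: supp)
  qed
  have "T \<tau> \<psi> \<psi>' x = (\<Sum>j\<in>UNIV. T1 j x) + (\<Sum>i\<in>UNIV. T2 i x)" for x
  proof -
    have DD: "(\<Sum>j\<in>UNIV. u' j x * u' j x) = (norm (D x))\<^sup>2"
      unfolding norm_vec_sq by (simp add: D_def power2_eq_square)
    have DdG: "(\<Sum>j\<in>UNIV. dG x $ j * u' j x) = D x \<bullet> dG x"
      by (simp add: inner_vec_def D_def mult.commute)
    have DAD: "(\<Sum>j\<in>UNIV. AD x $ j * u' j x) = D x \<bullet> AD x"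
      by (simp add: inner_vec_def D_def mult.commute)
    have "(\<Sum>j\<in>UNIV. L' j x * (u' j x * \<phi> x)) = - (p * u x powr (p - 1) * (\<Sum>j\<in>UNIV. u' j x * u' j x)
       + M * (q * (\<Sum>j\<in>UNIV. dG x $ j * u' j x))) * \<phi> x"
    proof -
      have "L' j x * (u' j x * \<phi> x) = - (p * u x powr (p - 1) * \<phi> x) * (u' j x * u' j x)
          - M * q * \<phi> x * (dG x $ j * u' j x)" for j
        by (simp add: L'_def algebra_simps)
      then show ?thesis
        by (simp only: sum_subtractf flip: sum_distrib_left) (simp add: algebra_simps)
    qed
    moreover have "(\<Sum>j\<in>UNIV. \<Sum>i\<in>UNIV. u'' j i x * (u'' i j x * \<phi> x + u' j x * \<phi>' i x))
      = (norm (A x))\<^sup>2 * \<phi> x + (\<Sum>i\<in>UNIV. AD x $ i * \<phi>' i x)"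
    proof -
      have "(\<Sum>j\<in>UNIV. \<Sum>i\<in>UNIV. u'' j i x * (u'' i j x * \<phi> x)) = (norm (A x))\<^sup>2 * \<phi> x"
        unfolding norm_mat_sq sum_distrib_right
        by (intro sum.cong refl) (simp add: A_def power2_eq_square hessian_symmetric)
      moreover have "(\<Sum>j\<in>UNIV. \<Sum>i\<in>UNIV. u'' j i x * (u' j x * \<phi>' i x)) = (\<Sum>i\<in>UNIV. AD x $ i * \<phi>' i x)"
        unfolding AD_nth sum_distrib_right
        by (subst sum.swap) (intro sum.cong refl, simp add: hessian_symmetric mult.assoc)
      ultimately show ?thesis
        by (simp add: distrib_left sum.distrib)
    qed
    moreover have "(\<Sum>i\<in>UNIV. AD x $ i * \<phi>' i x)
      = \<alpha> * u x powr (\<alpha> - 1) * (D x \<bullet> AD x) * \<psi> x + u x powr \<alpha> * (AD x \<bullet> \<psi>' x)"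
    proof -
      have "AD x $ i * \<phi>' i x = \<alpha> * u x powr (\<alpha> - 1) * \<psi> x * (AD x $ i * u' i x) + u x powr \<alpha> * (AD x $ i * \<psi>' x $ i)" for i
        by (simp add: \<phi>'_def algebra_simps)
      moreover have "(\<Sum>i\<in>UNIV. AD x $ i * \<psi>' x $ i) = AD x \<bullet> \<psi>' x"
        by (simp add: inner_vec_def)
      ultimately show ?thesis
        by (simp only: sum.distrib DAD flip: sum_distrib_left) (simp add: algebra_simps)
    qed
    moreover have "(\<Sum>i\<in>UNIV. T2 i x) = H \<tau> x * (D x \<bullet> \<psi>' x) + \<psi> x * (\<Sum>i\<in>UNIV. u' i x * H' \<tau> i x)
      + \<psi> x * H \<tau> x * (\<Sum>i\<in>UNIV. u'' i i x)"
    proof -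
      have "T2 i x = H \<tau> x * (D x $ i * \<psi>' x $ i) + \<psi> x * (u' i x * H' \<tau> i x) + \<psi> x * H \<tau> x * u'' i i x" for i
        by (simp add: T2_def D_def algebra_simps)
      moreover have "(\<Sum>i\<in>UNIV. D x $ i * \<psi>' x $ i) = D x \<bullet> \<psi>' x"
        by (simp add: inner_vec_def)
      ultimately show ?thesis
        by (simp only: sum.distrib flip: sum_distrib_left)
    qed
    ultimately show ?thesis
      unfolding T_def T1_def sum.distrib DD DdG equation
      by (simp add: \<phi>_def G_def D_def distrib_left right_diff_distrib)
  qed
  then have "T \<tau> \<psi> \<psi>' = (\<lambda>x. (\<Sum>j\<in>UNIV. T1 j x) + (\<Sum>i\<in>UNIV. T2 i x))" by blast
  then show "integrable lborel (T \<tau> \<psi> \<psi>')" "integral\<^sup>L lborel (T \<tau> \<psi> \<psi>') = 0"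
    using T1 T2 by (simp_all add: Bochner_Integration.integral_sum)
qed

text \<open>The terms without \<open>\<psi>'\<close> are bounded below by coercivity. The terms with \<open>\<psi>'\<close> are
\<open>E \<nabla>u + (\<tau> - M/n) |\<nabla>u|\<^sup>q \<nabla>u\<close> paired with \<open>\<psi>'\<close>, and \<open>|E|\<close> and \<open>|\<nabla>u|\<^sup>q\<close> are at most \<open>P\<^sup>1\<^sup>/\<^sup>2\<close>, while
\<open>|\<nabla>u|\<close> is at most \<open>P\<close> to the power \<open>1/(2q)\<close>.\<close>

lemma T_ge:
  assumes p': "p \<le> (n + 2) / (n - 2)" and coer: "coercive n p q M s c" and \<psi>: "\<psi> x \<ge> 0"
  defines "\<tau> \<equiv> M * (1 / n - s * ((n - 1) / n))"
  shows "T \<tau> \<psi> \<psi>' x \<ge> u x powr \<alpha> * (c * P x * \<psi> x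
    - (1 + \<bar>\<tau> - M / n\<bar>) * P x powr (1 / 2 + 1 / (2 * q)) * norm (\<psi>' x))"
proof -
  define a where "a = n / (n - 2)"
  define b where "b = (n - 1) / (n - 2)"
  define \<kappa> where "\<kappa> = (n - 1) / n"
  define g where "g = (norm (D x))\<^sup>2"
  define X where "X = g / u x"
  define y where "y = u x powr p"
  define f where "f = y + M * G x"
  define w where "w = u x powr \<alpha>"
  define \<sigma> where "\<sigma> = (D x \<bullet> AD x) / g"
  define e where "e = \<sigma> - b * X + f / n"
  define l where "l = (f + a * X) / n"
  have ab: "a - a / n = b"
    using dim by (simp add: a_def b_def diff_divide_distrib)
  have u: "u x > 0" by (rule pos)
  have w: "w > 0" using u by (simp add: w_def)
  have E: "E x = (\<chi> i j. A x $ i $ j - a / u x * D x $ i * D x $ j + (if i = j then l else 0))"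
    unfolding E_def a_def l_def X_def g_def f_def y_def by (simp only: times_divide_eq_right)
  have trA: "trace (A x) = - f"
    using equation[of x] by (simp add: trace_def A_def f_def y_def G_def D_def)
  have ln: "l * real CARD('n) = a / u x * g - trace (A x)"
    using dim by (simp add: l_def trA X_def n[symmetric])
  note hess = norm_sq_conformal_hessian[OF E ln[unfolded g_def], folded g_def]
  have E_D: "E x *v D x = AD x - (a * X - l) *\<^sub>R D x"
    using hess(2) by (simp add: AD_def X_def)
  have DED: "D x \<bullet> (E x *v D x) = g * e"
  proof (cases "g = 0")
    case True then show ?thesis by (simp add: g_def)
  next
    case False
    have "D x \<bullet> (E x *v D x) = D x \<bullet> AD x - (a * X - l) * g"
      unfolding E_D g_def by (simp add: inner_diff_right power2_norm_eq_inner)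
    also have "\<dots> = g * (\<sigma> - a * X + l)"
      using False by (simp add: \<sigma>_def algebra_simps)
    also have "\<sigma> - a * X + l = e"
      unfolding ab[symmetric] e_def l_def by (simp add: algebra_simps add_divide_distrib)
    finally show ?thesis .
  qed
  have A2: "(norm (A x))\<^sup>2 = (norm (E x))\<^sup>2 + 2 * a * X * e + \<kappa> * a\<^sup>2 * X\<^sup>2 + f\<^sup>2 / n"
  proof -
    have "(norm (A x))\<^sup>2 = (norm (E x))\<^sup>2 + 2 * a * X * e + (a\<^sup>2 * X\<^sup>2 - 2 * a * l * X + l\<^sup>2 * n)"
      unfolding hess(3) DED n[symmetric] by (simp add: X_def power_divide)
    also have "a\<^sup>2 * X\<^sup>2 - 2 * a * l * X + l\<^sup>2 * n = \<kappa> * a\<^sup>2 * X\<^sup>2 + f\<^sup>2 / n"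
    proof -
      have "l\<^sup>2 * n = (f + a * X)\<^sup>2 / n" using dim by (simp add: l_def power2_eq_square)
      then show ?thesis using dim by (simp add: l_def \<kappa>_def field_simps power2_eq_square)
    qed
    finally show ?thesis by (simp add: algebra_simps)
  qed
  have DAD: "D x \<bullet> AD x = g * \<sigma>"
    by (cases "g = 0") (simp_all add: \<sigma>_def g_def)
  have DdG: "D x \<bullet> dG x = G x * \<sigma>"
  proof (cases "D x = 0")
    case True then show ?thesis using q1 by (simp add: G_def)
  next
    case False
    then have "norm (D x) powr (q - 2) * g = G x"
      unfolding g_def G_def by (simp add: powr_diff)
    then show ?thesis
      by (simp add: dG_def DAD flip: mult.assoc)
  qed
  have pw: "u x powr (\<alpha> - 1) = w / u x" "u x powr (\<alpha> - 1 - 1) = w / (u x)\<^sup>2" "u x powr (\<alpha> + p) = w * y"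
      "u x powr (\<alpha> + p - 1) = w * y / u x" "u x powr (p - 1) = y / u x"
    using u by (simp_all add: w_def y_def powr_diff powr_add power2_eq_square)
  have H: "H \<tau> x = w * (- b * X + y / n + \<tau> * G x)"
    unfolding H_def pw by (simp add: b_def X_def g_def w_def[symmetric] algebra_simps)
  have "(\<Sum>i\<in>UNIV. u' i x * H' \<tau> i x) = - b * ((\<alpha> - 1) * (w / (u x)\<^sup>2) * g * g + w / u x * (2 * (D x \<bullet> AD x)))
     + 1 / n * ((\<alpha> + p) * (w * y / u x) * g) + \<tau> * (\<alpha> * (w / u x) * G x * g + w * (q * (D x \<bullet> dG x)))"
  proof -
    have "u' i x * H' \<tau> i x = (- b * (\<alpha> - 1) * (w / (u x)\<^sup>2) * g + 1 / n * (\<alpha> + p) * (w * y / u x) + \<tau> * \<alpha> * (w / u x) * G x) * (D x $ i * D x $ i)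
       + (- b * (w / u x) * 2) * (D x $ i * AD x $ i) + \<tau> * w * q * (D x $ i * dG x $ i)" for i
      unfolding H'_def pw g_def[symmetric] b_def[symmetric] w_def[symmetric] by (simp add: D_def algebra_simps add_divide_distrib)
    moreover have "(\<Sum>i\<in>UNIV. D x $ i * D x $ i) = g" "(\<Sum>i\<in>UNIV. D x $ i * AD x $ i) = D x \<bullet> AD x"
        "(\<Sum>i\<in>UNIV. D x $ i * dG x $ i) = D x \<bullet> dG x"
      unfolding g_def power2_norm_eq_inner by (simp_all add: inner_vec_def)
    ultimately show ?thesis
      by (simp only: sum.distrib flip: sum_distrib_left) (simp add: algebra_simps add_divide_distrib)
  qed
  also have "\<dots> = w * (\<alpha> * X * (- b * X + y / n + \<tau> * G x) - b * (2 * X * \<sigma> - X\<^sup>2) + p * y * X / n + \<tau> * q * G x * \<sigma>)"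
    unfolding DAD DdG by (simp add: X_def power2_eq_square algebra_simps add_divide_distrib diff_divide_distrib)
  finally have DH: "(\<Sum>i\<in>UNIV. u' i x * H' \<tau> i x) = w * (\<alpha> * X * (- b * X + y / n + \<tau> * G x) - b * (2 * X * \<sigma> - X\<^sup>2) + p * y * X / n + \<tau> * q * G x * \<sigma>)" .
  define J where "J = (norm (A x))\<^sup>2 - p * y * X - M * q * G x * \<sigma> + \<alpha> * X * \<sigma>
      + (\<alpha> * X * (- b * X + y / n + \<tau> * G x) - b * (2 * X * \<sigma> - X\<^sup>2) + p * y * X / n + \<tau> * q * G x * \<sigma>)
      - f * (- b * X + y / n + \<tau> * G x)"
  define r where "r = AD x \<bullet> \<psi>' x + (- b * X + y / n + \<tau> * G x) * (D x \<bullet> \<psi>' x)"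
  have T: "T \<tau> \<psi> \<psi>' x = w * (J * \<psi> x + r)"
    unfolding T_def H DH DAD DdG pw g_def[symmetric] w_def[symmetric] y_def[symmetric] f_def[symmetric] J_def r_def
    by (simp add: X_def algebra_simps)
  have "J = (norm (E x))\<^sup>2 + \<kappa> * (((n + 2) / (n - 2) - p) * y * X
        + M * G x * ((n + 2 - q * (n - 1) - s * (q * (n - 1) - 2)) / (n - 2) * X - q * (1 + s) * e
            + (q / n + s * (1 + q / n)) * f))"
    unfolding J_def
    by (rule obata_identity[OF _ a_def b_def \<alpha>_def \<kappa>_def _ f_def A2])
      (use dim in \<open>auto simp: \<tau>_def \<kappa>_def e_def\<close>)
  moreover have "G x \<le> X + y"
    using gradient_power_le[OF _ u p q, of "norm (D x)"] by (simp add: G_def X_def g_def y_def)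
  moreover have "G x = 0 \<or> e\<^sup>2 \<le> \<kappa> * (norm (E x))\<^sup>2"
  proof (cases "D x = 0")
    case True then show ?thesis using q1 by (simp add: G_def)
  next
    case False
    then have "g > 0" by (simp add: g_def)
    moreover have "(g * e)\<^sup>2 \<le> \<kappa> * (norm (E x))\<^sup>2 * g\<^sup>2"
      using trace_free_quadratic_form_le[OF hess(1), of "D x"] unfolding DED g_def[symmetric] n[symmetric] \<kappa>_def[symmetric] .
    ultimately show ?thesis by (simp add: power_mult_distrib)
  qed
  moreover have "X \<ge> 0" "y \<ge> 0" "G x \<ge> 0"
    using u by (simp_all add: X_def g_def y_def G_def)
  ultimately have J: "J \<ge> c * P x"
    using coer[unfolded coercive_def \<kappa>_def[symmetric], rule_format, of "(norm (E x))\<^sup>2" X y "G x" e]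
    unfolding P_def f_def by simp
  have "r = (E x *v D x) \<bullet> \<psi>' x + (\<tau> - M / n) * G x * (D x \<bullet> \<psi>' x)"
  proof -
    have "AD x = E x *v D x + (a * X - l) *\<^sub>R D x" by (simp add: E_D)
    moreover have "a * X - l - b * X + y / n + \<tau> * G x = (\<tau> - M / n) * G x"
      unfolding ab[symmetric] l_def f_def by (simp add: algebra_simps add_divide_distrib)
    ultimately show ?thesis
      unfolding r_def by (simp add: inner_add_left flip: distrib_right)
  qed
  also have "\<bar>\<dots>\<bar> \<le> norm (E x) * norm (D x) * norm (\<psi>' x) + \<bar>\<tau> - M / n\<bar> * G x * (norm (D x) * norm (\<psi>' x))"
  proof -
    have "\<bar>(E x *v D x) \<bullet> \<psi>' x\<bar> \<le> norm (E x *v D x) * norm (\<psi>' x)"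
      by (rule Cauchy_Schwarz_ineq2)
    also have "\<dots> \<le> norm (E x) * norm (D x) * norm (\<psi>' x)"
      by (intro mult_right_mono norm_matrix_vector_le) auto
    finally have "\<bar>(E x *v D x) \<bullet> \<psi>' x\<bar> \<le> norm (E x) * norm (D x) * norm (\<psi>' x)" .
    moreover have "\<bar>(\<tau> - M / n) * G x * (D x \<bullet> \<psi>' x)\<bar> \<le> \<bar>\<tau> - M / n\<bar> * G x * (norm (D x) * norm (\<psi>' x))"
      unfolding abs_mult using Cauchy_Schwarz_ineq2[of "D x" "\<psi>' x"]
      by (intro mult_mono) (auto simp: G_def)
    ultimately show ?thesis by linarith
  qed
  also have "\<dots> = (norm (E x) + \<bar>\<tau> - M / n\<bar> * G x) * norm (D x) * norm (\<psi>' x)"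
    by (simp add: algebra_simps)
  also have "\<dots> \<le> ((1 + \<bar>\<tau> - M / n\<bar>) * P x powr (1 / 2)) * P x powr (1 / (2 * q)) * norm (\<psi>' x)"
  proof -
    have sq: "P x powr (1 / 2) = sqrt (P x)" by (simp add: powr_half_sqrt P_def)
    have "norm (E x) \<le> P x powr (1 / 2)" and G: "G x \<le> P x powr (1 / 2)"
      unfolding sq unfolding P_def by (auto intro!: real_le_rsqrt)
    moreover from G have "\<bar>\<tau> - M / n\<bar> * G x \<le> \<bar>\<tau> - M / n\<bar> * P x powr (1 / 2)"
      by (intro mult_left_mono) auto
    ultimately have 1: "norm (E x) + \<bar>\<tau> - M / n\<bar> * G x \<le> (1 + \<bar>\<tau> - M / n\<bar>) * P x powr (1 / 2)"
      by (simp add: algebra_simps)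
    have "norm (D x) = G x powr (1 / q)"
      using q1 by (simp add: G_def powr_powr)
    also have "\<dots> \<le> (P x powr (1 / 2)) powr (1 / q)"
      using G q1 by (intro powr_mono2) (auto simp: G_def)
    finally have 2: "norm (D x) \<le> P x powr (1 / (2 * q))"
      by (simp add: powr_powr)
    show ?thesis
      using 1 2 by (intro mult_mono) (auto simp: G_def)
  qed
  also have "\<dots> = (1 + \<bar>\<tau> - M / n\<bar>) * P x powr (1 / 2 + 1 / (2 * q)) * norm (\<psi>' x)"
    by (simp add: powr_add)
  finally have r: "\<bar>r\<bar> \<le> (1 + \<bar>\<tau> - M / n\<bar>) * P x powr (1 / 2 + 1 / (2 * q)) * norm (\<psi>' x)" .
  have "c * P x * \<psi> x \<le> J * \<psi> x"
    using J \<psi> by (rule mult_right_mono)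
  with r have "c * P x * \<psi> x - (1 + \<bar>\<tau> - M / n\<bar>) * P x powr (1 / 2 + 1 / (2 * q)) * norm (\<psi>' x) \<le> J * \<psi> x + r"
    by linarith
  then show ?thesis
    unfolding T w_def[symmetric] using w by (intro mult_left_mono) auto
qed

end

section \<open>Cut-off functions and passage to the limit\<close>

lemma DERIV_positive_part_power:
  fixes t :: real and k :: nat
  assumes "k \<ge> 2"
  shows "((\<lambda>t. (max 0 t) ^ k) has_real_derivative real k * (max 0 t) ^ (k - 1)) (at t)"
proof -
  consider "t > 0" | "t < 0" | "t = 0" by linarith
  then show ?thesis
  proof cases
    case 1
    have "((\<lambda>t. t ^ k) has_real_derivative real k * t ^ (k - 1)) (at t)"
      by (auto intro!: derivative_eq_intros)
    moreover have "eventually (\<lambda>s. s ^ k = (max 0 s) ^ k) (nhds t)"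
      using eventually_nhds_in_open[of "{0<..}" t] 1 by (auto elim!: eventually_mono)
    ultimately have "((\<lambda>t. (max 0 t) ^ k) has_real_derivative real k * t ^ (k - 1)) (at t)"
      by (rule iffD1[OF DERIV_cong_ev[OF refl _ refl], rotated])
    then show ?thesis using 1 by simp
  next
    case 2
    have "eventually (\<lambda>s. (max 0 s) ^ k = 0) (nhds t)"
      using eventually_nhds_in_open[of "{..<0}" t] 2 assms by (auto elim!: eventually_mono)
    then have "((\<lambda>t. (max 0 t) ^ k) has_real_derivative 0) (at t) \<longleftrightarrow> ((\<lambda>_. 0::real) has_real_derivative 0) (at t)"
      by (intro DERIV_cong_ev) auto
    then show ?thesis using 2 assms by (simp add: power_0_left)
  next
    case 3
    have "((\<lambda>h :: real. \<bar>h\<bar> ^ (k - 1)) \<longlongrightarrow> \<bar>0\<bar> ^ (k - 1)) (at 0)"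
      by (intro tendsto_intros)
    then have lim: "((\<lambda>h :: real. \<bar>h\<bar> ^ (k - 1)) \<longlongrightarrow> 0) (at 0)"
      using assms by (simp add: power_0_left)
    have "norm ((max 0 h) ^ k / h) \<le> \<bar>h\<bar> ^ (k - 1)" for h :: real
    proof (cases "h > 0")
      case True
      then show ?thesis using assms by (cases k) auto
    next
      case False
      then show ?thesis using assms by (simp add: power_0_left)
    qed
    then have "((\<lambda>h :: real. (max 0 h) ^ k / h) \<longlongrightarrow> 0) (at 0)"
      by (intro Lim_null_comparison[OF always_eventually lim]) auto
    then show ?thesis
      using 3 assms by (simp add: DERIV_def power_0_left)
  qed
qed

text \<open>The free parameter \<open>N\<close> serves twice: a small value makes the first term absorbable, and letting
\<open>N\<close> tend to infinity makes the second one disappear.\<close>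

lemma young_with_parameter:
  fixes a N R \<theta> :: real
  assumes "a \<ge> 0" "N > 0" "R > 0" "0 < \<theta>" "\<theta> < 1"
  shows "a powr \<theta> / R \<le> N * a + N powr (- \<theta> / (1 - \<theta>)) * R powr (- 1 / (1 - \<theta>))"
proof (cases "1 / (N * R) \<le> a powr (1 - \<theta>)")
  case True
  moreover have "1 / (N * R) > 0" using assms by simp
  ultimately have "a \<noteq> 0" by auto
  then have a: "a > 0" using assms by simp
  have "1 / R \<le> N * a powr (1 - \<theta>)"
    using True assms by (simp add: field_simps)
  then have "a powr \<theta> * (1 / R) \<le> a powr \<theta> * (N * a powr (1 - \<theta>))"
    by (intro mult_left_mono) auto
  also have "\<dots> = N * a"
    using a by (simp flip: powr_add)
  finally show ?thesis by (simp add: add_increasing2)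
next
  case False
  have "a powr \<theta> = (a powr (1 - \<theta>)) powr (\<theta> / (1 - \<theta>))"
    using assms by (simp add: powr_powr)
  also have "\<dots> \<le> (1 / (N * R)) powr (\<theta> / (1 - \<theta>))"
    using False assms by (intro powr_mono2) auto
  also have "\<dots> = N powr (- \<theta> / (1 - \<theta>)) * R powr (- \<theta> / (1 - \<theta>))"
    using assms by (simp add: powr_divide powr_mult powr_minus_divide)
  finally have "a powr \<theta> / R \<le> N powr (- \<theta> / (1 - \<theta>)) * R powr (- \<theta> / (1 - \<theta>)) / R"
    using assms by (intro divide_right_mono) auto
  also have "\<dots> = N powr (- \<theta> / (1 - \<theta>)) * (R powr (- \<theta> / (1 - \<theta>)) * R powr (-1))"
    using powr_minus_divide[of R 1] assms by simp
  also have "R powr (- \<theta> / (1 - \<theta>)) * R powr (-1) = R powr (- 1 / (1 - \<theta>))"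
  proof -
    have "- \<theta> / (1 - \<theta>) + (- 1) = - 1 / (1 - \<theta>)" using assms by (simp add: field_simps)
    then show ?thesis by (simp only: flip: powr_add)
  qed
  finally show ?thesis using assms by (simp add: add_increasing)
qed

lemma continuous_nonneg_integral_le_0:
  fixes W :: "real ^ 'n::finite \<Rightarrow> real"
  assumes cont: "continuous_on UNIV W" and nonneg: "\<And>x. W x \<ge> 0"
    and int: "integrable lborel W" and le: "integral\<^sup>L lborel W \<le> 0"
  shows "W x = 0"
proof (rule ccontr)
  assume "W x \<noteq> 0"
  define \<epsilon> where "\<epsilon> = W x / 2"
  have \<epsilon>: "\<epsilon> > 0" using \<open>W x \<noteq> 0\<close> nonneg[of x] by (simp add: \<epsilon>_def)
  have "isCont W x" using cont by (simp add: continuous_on_eq_continuous_at)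
  then obtain d where d: "d > 0" "\<And>y. dist y x < d \<Longrightarrow> dist (W y) (W x) < \<epsilon>"
    using \<epsilon> unfolding continuous_at_eps_delta by blast
  have big: "W y \<ge> \<epsilon>" if "y \<in> ball x d" for y
  proof -
    have "\<bar>W y - W x\<bar> < \<epsilon>"
      using d(2)[of y] that by (simp add: dist_commute dist_real_def)
    moreover have "W x = 2 * \<epsilon>" by (simp add: \<epsilon>_def)
    ultimately show ?thesis by linarith
  qed
  have "integrable lborel (\<lambda>y. \<epsilon> * indicator (ball x d) y)"
    using emeasure_lborel_ball_finite by (intro integrable_mult_right) (auto simp: integrable_indicator_iff)
  then have "integral\<^sup>L lborel (\<lambda>y. \<epsilon> * indicator (ball x d) y) \<le> integral\<^sup>L lborel W"
    using int big nonneg by (intro integral_mono) (auto simp: indicator_def)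
  moreover have "integral\<^sup>L lborel (\<lambda>y. \<epsilon> * indicator (ball x d) y) = \<epsilon> * measure lborel (ball x d)"
    by simp
  moreover have "measure lborel (ball x d) > 0"
    using content_ball_pos[OF d(1)] .
  ultimately show False
    using le \<epsilon> by (smt (verit) mult_pos_pos)
qed

text \<open>A fixed small \<open>N\<close> bounds the integrals of \<open>W \<psi>\<^sub>m\<close>, so \<open>W\<close> is integrable. The factor \<open>|x|/(m+1)\<close>
tends to zero pointwise, so by dominated convergence the first term on the right of the inequality
vanishes in the limit for every \<open>N\<close>; then \<open>N\<close> tends to infinity.\<close>

lemma absorb_in_the_limit:
  fixes W :: "real ^ 'n::finite \<Rightarrow> real"
  assumes cont: "continuous_on UNIV W" and nonneg: "\<And>x. W x \<ge> 0"
    and \<psi>: "\<And>m. continuous_on UNIV (\<psi> m)" "\<And>m x. 0 \<le> \<psi> m x" "\<And>m x. \<psi> m x \<le> 1"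
      "\<And>m x. norm x > Suc m \<Longrightarrow> \<psi> m x = 0" "\<And>x. mono (\<lambda>m. \<psi> m x)" "\<And>x. (\<lambda>m. \<psi> m x) \<longlonglongrightarrow> 1"
    and c: "c > 0" "C > 0" "\<beta> > 0"
    and ineq: "\<And>m N. N > 0 \<Longrightarrow> c * integral\<^sup>L lborel (\<lambda>x. W x * \<psi> m x)
      \<le> C * N * integral\<^sup>L lborel (\<lambda>x. norm x / Suc m * (W x * \<psi> m x)) + C' * N powr (- \<beta>)"
  shows "W x = 0"
proof -
  have int1: "integrable lborel (\<lambda>x. W x * \<psi> m x)" for m
    using \<psi> by (intro integrable_continuous_support[where R="Suc m"] continuous_intros cont) auto
  have int2: "integrable lborel (\<lambda>x. norm x / Suc m * (W x * \<psi> m x))" for m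
    using \<psi> by (intro integrable_continuous_support[where R="Suc m"] continuous_intros cont) auto
  have le1: "norm x / Suc m * (W x * \<psi> m x) \<le> W x * \<psi> m x" for m x
  proof (cases "norm x > Suc m")
    case True then show ?thesis using \<psi> by simp
  next
    case False
    then have "norm x / Suc m \<le> 1" by (simp add: divide_le_eq)
    then show ?thesis using nonneg \<psi> by (intro mult_left_le_one_le) auto
  qed
  have monoI: "mono (\<lambda>m. W x * \<psi> m x)" for x
    using \<psi>(5)[of x] nonneg[of x] by (auto simp: mono_def intro!: mult_left_mono)
  have limW: "(\<lambda>m. W x * \<psi> m x) \<longlonglongrightarrow> W x" for x
    using tendsto_mult[OF tendsto_const \<psi>(6)[of x], of "W x"] by simp
  \<comment> \<open>For this \<open>N\<close> the first term on the right is at most half of the left-hand side.\<close>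
  define N0 where "N0 = c / (2 * C)"
  have "N0 > 0" using c by (simp add: N0_def)
  have bound: "integral\<^sup>L lborel (\<lambda>x. W x * \<psi> m x) \<le> 2 / c * (C' * N0 powr (- \<beta>))" for m
  proof -
    define I1 where "I1 = integral\<^sup>L lborel (\<lambda>x. W x * \<psi> m x)"
    define I2 where "I2 = integral\<^sup>L lborel (\<lambda>x. norm x / Suc m * (W x * \<psi> m x))"
    have "I2 \<le> I1"
      unfolding I1_def I2_def by (intro integral_mono int1 int2 le1)
    have half: "C * N0 = c / 2" using c by (simp add: N0_def)
    have "c / 2 * I2 \<le> c / 2 * I1"
      using c \<open>I2 \<le> I1\<close> by (intro mult_left_mono) auto
    moreover have "c * I1 \<le> C * N0 * I2 + C' * N0 powr (- \<beta>)"
      unfolding I1_def I2_def by (rule ineq[OF \<open>N0 > 0\<close>])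
    ultimately have "c * I1 \<le> 2 * (C' * N0 powr (- \<beta>))"
      unfolding half by linarith
    then show ?thesis using c unfolding I1_def[symmetric] by (simp add: field_simps)
  qed
  have "incseq (\<lambda>m. integral\<^sup>L lborel (\<lambda>x. W x * \<psi> m x))"
    using monoI by (intro incseq_SucI integral_mono int1) (auto simp: mono_def)
  then obtain I where "(\<lambda>m. integral\<^sup>L lborel (\<lambda>x. W x * \<psi> m x)) \<longlonglongrightarrow> I"
    using incseq_convergent bound by blast
  moreover have meas: "W \<in> borel_measurable lborel"
    using cont by (simp add: borel_measurable_continuous_onI)
  ultimately have intW: "integrable lborel W"
    using monoI limW nonneg \<psi> by (intro integral_monotone_convergence_nonneg(1)[OF int1]) auto
  have lim1: "(\<lambda>m. integral\<^sup>L lborel (\<lambda>x. W x * \<psi> m x)) \<longlonglongrightarrow> integral\<^sup>L lborel W"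
    by (rule integral_dominated_convergence[OF meas _ intW])
      (use int1 limW nonneg \<psi> in \<open>auto intro!: mult_right_le_one_le borel_measurable_integrable simp: abs_mult\<close>)
  have lim2: "(\<lambda>m. integral\<^sup>L lborel (\<lambda>x. norm x / Suc m * (W x * \<psi> m x))) \<longlonglongrightarrow> integral\<^sup>L lborel (\<lambda>x :: real ^ 'n. 0)"
  proof (rule integral_dominated_convergence[OF _ _ intW])
    show "(\<lambda>x. norm x / Suc m * (W x * \<psi> m x)) \<in> borel_measurable lborel" for m
      using int2 by (rule borel_measurable_integrable)
    show "AE x in lborel. (\<lambda>m. norm x / Suc m * (W x * \<psi> m x)) \<longlonglongrightarrow> 0"
    proof (rule AE_I2)
      fix x :: "real ^ 'n"
      have "(\<lambda>m. norm x * inverse (real (Suc m)) * (W x * \<psi> m x)) \<longlonglongrightarrow> norm x * 0 * W x"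
        by (intro tendsto_mult tendsto_const LIMSEQ_inverse_real_of_nat limW)
      then show "(\<lambda>m. norm x / Suc m * (W x * \<psi> m x)) \<longlonglongrightarrow> 0"
        by (simp add: divide_inverse)
    qed
    show "AE x in lborel. norm (norm x / Suc m * (W x * \<psi> m x)) \<le> W x" for m
    proof (rule AE_I2)
      fix x :: "real ^ 'n"
      have "norm (norm x / Suc m * (W x * \<psi> m x)) = norm x / Suc m * (W x * \<psi> m x)"
        using nonneg \<psi> by simp
      also have "\<dots> \<le> W x * \<psi> m x" by (rule le1)
      also have "\<dots> \<le> W x" using nonneg \<psi> by (simp add: mult_left_le)
      finally show "norm (norm x / Suc m * (W x * \<psi> m x)) \<le> W x" .
    qed
  qed simp
  have le: "c * integral\<^sup>L lborel W \<le> C' * N powr (- \<beta>)" if "N > 0" for N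
  proof -
    have "c * integral\<^sup>L lborel W \<le> C * N * integral\<^sup>L lborel (\<lambda>x :: real ^ 'n. 0) + C' * N powr (- \<beta>)"
      by (rule LIMSEQ_le[OF tendsto_mult[OF tendsto_const lim1] tendsto_add[OF tendsto_mult[OF tendsto_const lim2] tendsto_const]])
        (use ineq[OF that] in auto)
    then show ?thesis by simp
  qed
  have "((\<lambda>N. C' * N powr (- \<beta>)) \<longlongrightarrow> C' * 0) at_top"
    using c by (intro tendsto_mult tendsto_const tendsto_neg_powr filterlim_ident) auto
  moreover have "eventually (\<lambda>N. c * integral\<^sup>L lborel W \<le> C' * N powr (- \<beta>)) at_top"
    using eventually_gt_at_top[of 0] by eventually_elim (rule le)
  ultimately have "c * integral\<^sup>L lborel W \<le> C' * 0"
    by (rule tendsto_lowerbound) simp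
  then have "integral\<^sup>L lborel W \<le> 0"
    using c by (simp add: mult_le_0_iff)
  then show ?thesis
    by (rule continuous_nonneg_integral_le_0[OF cont nonneg intW])
qed

lemma integral_linear_combination:
  fixes f g h :: "'a \<Rightarrow> real"
  assumes "integrable M f" "integrable M g" "integrable M h"
  shows "integral\<^sup>L M (\<lambda>x. a * f x - b * g x - d * h x)
    = a * integral\<^sup>L M f - b * integral\<^sup>L M g - d * integral\<^sup>L M h"
  using assms by simp

text \<open>A profile without a plateau: its gradient carries the factor \<open>|x|/R\<close>, which plays the part of
a support in an annulus.\<close>

definition cutoff :: "nat \<Rightarrow> real \<Rightarrow> real ^ 'n::finite \<Rightarrow> real" where
  "cutoff k R x = (max 0 (1 - (norm x)\<^sup>2 / R\<^sup>2)) ^ k"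

definition cutoff_grad :: "nat \<Rightarrow> real \<Rightarrow> real ^ 'n::finite \<Rightarrow> real ^ 'n" where
  "cutoff_grad k R x = (- 2 * real k / R\<^sup>2 * (max 0 (1 - (norm x)\<^sup>2 / R\<^sup>2)) ^ (k - 1)) *\<^sub>R x"

lemma has_pd_cutoff:
  assumes "k \<ge> 2"
  shows "has_pd i (cutoff k R) x (cutoff_grad k R x $ i)"
proof -
  have "has_pd i (\<lambda>x. 1 - 1 / R\<^sup>2 * (norm (x - 0))\<^sup>2) x (0 - 1 / R\<^sup>2 * (2 * (x $ i - 0 $ i)))"
    by (intro has_pd_diff has_pd_const has_pd_cmult has_pd_sq_dist)
  then have "has_pd i (\<lambda>x. 1 - (norm x)\<^sup>2 / R\<^sup>2) x (- 2 * x $ i / R\<^sup>2)"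
    by simp
  from has_pd_chain[OF DERIV_positive_part_power[OF assms] this]
  show ?thesis
    by (simp add: cutoff_def[abs_def] cutoff_grad_def field_simps)
qed

lemma continuous_cutoff: "continuous_on UNIV (cutoff k R)"
  unfolding cutoff_def[abs_def] divide_inverse by (intro continuous_intros)

lemma continuous_cutoff_grad: "continuous_on UNIV (cutoff_grad k R)"
  unfolding cutoff_grad_def[abs_def] divide_inverse by (intro continuous_intros)

lemma cutoff_range: "0 \<le> cutoff k R x" "cutoff k R x \<le> 1"
  unfolding cutoff_def by (auto intro!: power_le_one)

lemma cutoff_outside:
  assumes "R > 0" "norm x > R" "k \<ge> 1"
  shows "cutoff k R x = 0"
proof -
  have "R\<^sup>2 \<le> (norm x)\<^sup>2" using assms by (intro power_mono) auto
  then show ?thesis using assms by (simp add: cutoff_def field_simps max_def)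
qed

lemma mono_cutoff: "mono (\<lambda>m. cutoff k (real (Suc m)) x)"
proof (rule monoI)
  fix l m :: nat assume "l \<le> m"
  have "(norm x)\<^sup>2 / (real (Suc m))\<^sup>2 \<le> (norm x)\<^sup>2 / (real (Suc l))\<^sup>2"
    using \<open>l \<le> m\<close> by (intro divide_left_mono power_mono) auto
  then show "cutoff k (real (Suc l)) x \<le> cutoff k (real (Suc m)) x"
    unfolding cutoff_def by (intro power_mono) auto
qed

lemma cutoff_tendsto_1: "(\<lambda>m. cutoff k (real (Suc m)) x) \<longlonglongrightarrow> 1"
proof -
  have "(\<lambda>m. (max 0 (1 - (norm x)\<^sup>2 * (inverse (real (Suc m)))\<^sup>2)) ^ k) \<longlonglongrightarrow> (max 0 (1 - (norm x)\<^sup>2 * 0\<^sup>2)) ^ k"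
    by (intro tendsto_intros LIMSEQ_inverse_real_of_nat)
  then show ?thesis
    by (simp add: cutoff_def divide_inverse power_inverse)
qed

lemma norm_cutoff_grad_le:
  fixes k :: nat and \<theta> :: real
  assumes R: "R > 0" and k: "k \<ge> 2" and \<theta>: "real k * \<theta> \<le> real (k - 1)"
  shows "norm (cutoff_grad k R x) \<le> 2 * real k * (norm x / R) * (cutoff k R x powr \<theta> / R)"
proof -
  define z where "z = max 0 (1 - (norm x)\<^sup>2 / R\<^sup>2)"
  have z: "0 \<le> z" "z \<le> 1" by (auto simp: z_def)
  have "z ^ (k - 1) \<le> (z ^ k) powr \<theta>"
  proof (cases "z = 0")
    case True then show ?thesis using k by (simp add: power_0_left)
  next
    case False
    then have "z > 0" using z by simp
    then have "z ^ (k - 1) = z powr (k - 1)" "(z ^ k) powr \<theta> = z powr (k * \<theta>)"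
      using k by (simp_all add: powr_powr flip: powr_realpow)
    moreover have "z powr (k - 1) \<le> z powr (k * \<theta>)"
      using \<theta> \<open>z > 0\<close> z by (intro powr_mono') auto
    ultimately show ?thesis by simp
  qed
  then have "2 * real k / R\<^sup>2 * z ^ (k - 1) * norm x \<le> 2 * real k / R\<^sup>2 * (z ^ k) powr \<theta> * norm x"
    by (intro mult_right_mono mult_left_mono) auto
  moreover have "norm (cutoff_grad k R x) = 2 * real k / R\<^sup>2 * z ^ (k - 1) * norm x"
    using z by (simp add: cutoff_grad_def abs_mult z_def)
  ultimately show ?thesis
    by (simp add: cutoff_def z_def power2_eq_square mult_ac)
qed

context positive_solution
begin

text \<open>The lower bound \<open>k (1 + |x|)\<^sup>2\<^sup>-\<^sup>n\<close> on \<open>u\<close> and \<open>(2 - n) \<alpha> = 2\<close> give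
\<open>u\<^sup>\<alpha> \<le> C (1 + |x|)\<^sup>2\<close>.\<close>

lemma weight_integral_le:
  "\<exists>C. \<forall>R\<ge>1. integral\<^sup>L lborel (\<lambda>x. indicator (cball 0 R) x * u x powr \<alpha>) \<le> C * R powr (n + 2)"
proof -
  have superharmonic: "(\<Sum>i\<in>UNIV. u'' i i x) \<le> 0" for x
  proof -
    have "u x powr p + M * norm (\<chi> i. u' i x) powr q \<ge> 0"
      using M by (intro add_nonneg_nonneg) auto
    then show ?thesis unfolding equation by linarith
  qed
  obtain k where k: "k > 0" "\<And>x. u x \<ge> k * (1 + norm x) powr (2 - n)"
    using superharmonic_lower_bound[OF pd pd2 cont_u superharmonic _ pos, folded n] pos dim n
    by (metis less_eq_real_def of_nat_le_iff of_nat_numeral)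
  have \<alpha>: "\<alpha> < 0" "(2 - n) * \<alpha> = 2" using dim by (auto simp: \<alpha>_def field_simps)
  have "integral\<^sup>L lborel (\<lambda>x. indicator (cball 0 R) x * u x powr \<alpha>) \<le> k powr \<alpha> * 4 * unit_ball_vol n * R powr (n + 2)" if "R \<ge> 1" for R
  proof -
    have le: "indicator (cball 0 R) x * u x powr \<alpha> \<le> (k powr \<alpha> * (4 * R\<^sup>2)) * indicator (cball 0 R) x" for x
    proof (cases "x \<in> cball 0 R")
      case True
      have pos1: "1 + norm x > 0" using norm_ge_zero[of x] by linarith
      have "u x powr \<alpha> \<le> (k * (1 + norm x) powr (2 - n)) powr \<alpha>"
        using k pos1 \<alpha> by (intro powr_mono2') auto
      also have "\<dots> = k powr \<alpha> * (1 + norm x) powr 2"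
        using k pos1 \<alpha> by (simp add: powr_mult powr_powr)
      also have "(1 + norm x) powr 2 \<le> (2 * R) powr 2"
        using True that pos1 by (intro powr_mono2) auto
      finally show ?thesis
        using True that k by (simp add: power_mult_distrib mult_left_mono)
    qed simp
    have "integrable lborel (\<lambda>x. indicator (cball 0 R) x *\<^sub>R u x powr \<alpha>)"
      by (intro borel_integrable_compact continuous_on_subset[OF cont_u_powr]) auto
    moreover have "integrable lborel (\<lambda>x :: real ^ 'n. (k powr \<alpha> * (4 * R\<^sup>2)) * indicator (cball 0 R) x)"
      using emeasure_lborel_cball_finite by (intro integrable_mult_right) (auto simp: integrable_indicator_iff)
    ultimately have "integral\<^sup>L lborel (\<lambda>x. indicator (cball 0 R) x * u x powr \<alpha>)
      \<le> integral\<^sup>L lborel (\<lambda>x :: real ^ 'n. (k powr \<alpha> * (4 * R\<^sup>2)) * indicator (cball 0 R) x)"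
      using le by (intro integral_mono) auto
    also have "\<dots> = k powr \<alpha> * (4 * R\<^sup>2) * (unit_ball_vol n * R ^ CARD('n))"
      using that content_cball[of R "0 :: real ^ 'n"] by (simp add: n)
    also have "R\<^sup>2 * R ^ CARD('n) = R powr (n + 2)"
      using that by (simp add: n powr_add powr_realpow mult.commute)
    then have "k powr \<alpha> * (4 * R\<^sup>2) * (unit_ball_vol n * R ^ CARD('n)) = k powr \<alpha> * 4 * unit_ball_vol n * R powr (n + 2)"
      by (simp add: mult_ac flip: \<open>R\<^sup>2 * R ^ CARD('n) = R powr (n + 2)\<close>)
    finally show ?thesis .
  qed
  then show ?thesis by blast
qed

text \<open>The exponent \<open>1/(1 - \<theta>) = 4p/(p-1)\<close> of Young's inequality is at least \<open>n + 2\<close> exactly when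
\<open>p \<le> (n+2)/(n-2)\<close>; it then compensates the growth of the integral of \<open>u\<^sup>\<alpha>\<close>.\<close>

lemma P_eq_0:
  assumes p': "p \<le> (n + 2) / (n - 2)" and coer: "coercive n p q M s c" and c: "c > 0"
  shows "P x = 0"
proof -
  define \<tau> where "\<tau> = M * (1 / n - s * ((n - 1) / n))"
  define \<theta> where "\<theta> = 1 / 2 + 1 / (2 * q)"
  have \<theta>: "0 < \<theta>" "\<theta> < 1" using q1 by (auto simp: \<theta>_def field_simps)
  have conj: "1 / (1 - \<theta>) = 4 * p / (p - 1)"
    using p by (simp add: \<theta>_def q field_simps)
  have conj_ge: "1 / (1 - \<theta>) \<ge> n + 2"
  proof -
    have "p * (n - 2) \<le> n + 2" using p' dim by (simp add: field_simps)
    then show ?thesis unfolding conj using p by (simp add: field_simps)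
  qed
  \<comment> \<open>So large that \<open>|\<nabla>\<psi>|\<close> is controlled by \<open>\<psi>\<^sup>\<theta>\<close>.\<close>
  define k where "k = nat \<lceil>1 / (1 - \<theta>)\<rceil>"
  have k_ge: "real k \<ge> 1 / (1 - \<theta>)" unfolding k_def by linarith
  then have k2: "k \<ge> 2" using conj_ge dim by linarith
  have k\<theta>: "real k * \<theta> \<le> real (k - 1)"
  proof -
    have "1 \<le> k * (1 - \<theta>)" using k_ge \<theta> by (simp add: field_simps)
    then have "real k * \<theta> \<le> real k - 1" by (simp add: algebra_simps)
    then show ?thesis using k2 by simp
  qed
  define K where "K = (1 + \<bar>\<tau> - M / n\<bar>) * (2 * real k)"
  have K: "K > 0" using k2 by (auto simp: K_def intro!: mult_pos_pos add_pos_nonneg)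
  define \<beta> where "\<beta> = \<theta> / (1 - \<theta>)"
  obtain C where C: "\<And>R. R \<ge> 1 \<Longrightarrow> integral\<^sup>L lborel (\<lambda>x. indicator (cball 0 R) x * u x powr \<alpha>) \<le> C * R powr (n + 2)"
    using weight_integral_le by blast
  define W where "W = (\<lambda>x. u x powr \<alpha> * P x)"
  have cW: "continuous_on UNIV W"
    unfolding W_def by (intro continuous_on_mult cont_u_powr cont_P)
  have P0: "P x \<ge> 0" for x by (simp add: P_def)
  have W0: "W x \<ge> 0" for x using P0 by (simp add: W_def)
  have "W x = 0"
  proof (rule absorb_in_the_limit[OF cW W0])
    let ?\<psi> = "\<lambda>m. cutoff k (real (Suc m)) :: real ^ 'n \<Rightarrow> real"
    show "continuous_on UNIV (?\<psi> m)" for m by (rule continuous_cutoff)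
    show "0 \<le> ?\<psi> m x" "?\<psi> m x \<le> 1" for m x by (rule cutoff_range)+
    show supp: "?\<psi> m x = 0" if "norm x > Suc m" for m x
      using that k2 by (intro cutoff_outside) auto
    show "mono (\<lambda>m. ?\<psi> m x)" for x
      by (rule mono_cutoff)
    show "(\<lambda>m. ?\<psi> m x) \<longlonglongrightarrow> 1" for x
      by (rule cutoff_tendsto_1)
    show "c > 0" "K > 0" "\<beta> > 0"
      using c K \<theta> by (auto simp: \<beta>_def)
    show "c * integral\<^sup>L lborel (\<lambda>x. W x * ?\<psi> m x)
      \<le> K * N * integral\<^sup>L lborel (\<lambda>x. norm x / Suc m * (W x * ?\<psi> m x)) + (K * C) * N powr (- \<beta>)"
      if N: "N > 0" for m N
    proof -
      define R where "R = real (Suc m)"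
      have R: "R \<ge> 1" by (simp add: R_def)
      define \<psi> where "\<psi> = ?\<psi> m"
      define \<rho> where "\<rho> = N powr (- \<beta>) * R powr (- (1 / (1 - \<theta>)))"
      let ?w = "\<lambda>x. indicator (cball 0 R) x * u x powr \<alpha>"
      have int1: "integrable lborel (\<lambda>x. W x * \<psi> x)"
        unfolding \<psi>_def using supp
        by (intro integrable_continuous_support[where R=R] continuous_on_mult cW continuous_cutoff) (auto simp: R_def)
      have int2: "integrable lborel (\<lambda>x. norm x / R * (W x * \<psi> x))"
        unfolding \<psi>_def using supp R
        by (intro integrable_continuous_support[where R=R] continuous_on_mult cW continuous_cutoff continuous_intros) (auto simp: R_def)
      have "integrable lborel (\<lambda>x. indicator (cball 0 R) x *\<^sub>R u x powr \<alpha>)"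
        by (intro borel_integrable_compact continuous_on_subset[OF cont_u_powr]) auto
      then have int3: "integrable lborel ?w" by simp
      have \<psi>_pd: "has_pd i \<psi> x (cutoff_grad k R x $ i)" for i x
        unfolding \<psi>_def R_def by (rule has_pd_cutoff[OF k2])
      have \<psi>_supp: "\<psi> x = 0" if "norm x > R" for x
        using supp that unfolding \<psi>_def R_def by blast
      note T = weak_identity[where R=R and \<tau>=\<tau>, OF \<psi>_pd continuous_cutoff_grad \<psi>_supp]
      have lower: "c * (W x * \<psi> x) - K * N * (norm x / R * (W x * \<psi> x)) - K * \<rho> * ?w x \<le> T \<tau> \<psi> (cutoff_grad k R) x" for x
      proof -
        have \<psi>0: "\<psi> x \<ge> 0" unfolding \<psi>_def by (rule cutoff_range)
        have "(1 + \<bar>\<tau> - M / n\<bar>) * P x powr \<theta> * norm (cutoff_grad k R x)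
          \<le> K * N * (norm x / R * (P x * \<psi> x)) + K * \<rho> * indicator (cball 0 R) x"
        proof (cases "norm x \<le> R")
          case True
          have "norm (cutoff_grad k R x) \<le> 2 * real k * (norm x / R) * (\<psi> x powr \<theta> / R)"
            unfolding \<psi>_def R_def[symmetric] using R k2 k\<theta> by (intro norm_cutoff_grad_le) auto
          then have "(1 + \<bar>\<tau> - M / n\<bar>) * P x powr \<theta> * norm (cutoff_grad k R x)
            \<le> (1 + \<bar>\<tau> - M / n\<bar>) * P x powr \<theta> * (2 * real k * (norm x / R) * (\<psi> x powr \<theta> / R))"
            by (intro mult_left_mono) auto
          also have "\<dots> = K * (norm x / R) * ((P x * \<psi> x) powr \<theta> / R)"
            using P0 \<psi>0 by (simp add: K_def powr_mult mult_ac)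
          also have "\<dots> \<le> K * (norm x / R) * (N * (P x * \<psi> x) + N powr (- \<theta> / (1 - \<theta>)) * R powr (- 1 / (1 - \<theta>)))"
            using P0 \<psi>0 N R \<theta> K by (intro mult_left_mono young_with_parameter) auto
          also have "\<dots> = K * N * (norm x / R * (P x * \<psi> x)) + norm x / R * (K * \<rho>)"
            by (simp add: \<rho>_def \<beta>_def algebra_simps)
          also have "norm x / R * (K * \<rho>) \<le> 1 * (K * \<rho>)"
            using True R K by (intro mult_right_mono) (auto simp: \<rho>_def)
          finally show ?thesis using True by simp
        next
          case False
          then have "cutoff_grad k R x = 0"
            using R k2 cutoff_outside[of R x "k - 1"] by (simp add: cutoff_grad_def cutoff_def)
          then show ?thesis using False P0 \<psi>0 K N R by simp
        qed
        then have "u x powr \<alpha> * (c * P x * \<psi> x - (K * N * (norm x / R * (P x * \<psi> x)) + K * \<rho> * indicator (cball 0 R) x))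
          \<le> u x powr \<alpha> * (c * P x * \<psi> x - (1 + \<bar>\<tau> - M / n\<bar>) * P x powr \<theta> * norm (cutoff_grad k R x))"
          by (intro mult_left_mono) auto
        also have "\<dots> \<le> T \<tau> \<psi> (cutoff_grad k R) x"
          unfolding \<tau>_def \<theta>_def by (rule T_ge[where \<psi>=\<psi>, OF p' coer \<psi>0])
        finally show ?thesis by (simp add: W_def algebra_simps)
      qed
      have "integral\<^sup>L lborel (\<lambda>x. c * (W x * \<psi> x) - K * N * (norm x / R * (W x * \<psi> x)) - K * \<rho> * ?w x)
          \<le> integral\<^sup>L lborel (T \<tau> \<psi> (cutoff_grad k R))"
        by (intro integral_mono Bochner_Integration.integrable_diff integrable_mult_right int1 int2 int3 T(1) lower)
      moreover have "integral\<^sup>L lborel (\<lambda>x. c * (W x * \<psi> x) - K * N * (norm x / R * (W x * \<psi> x)) - K * \<rho> * ?w x)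
        = c * integral\<^sup>L lborel (\<lambda>x. W x * \<psi> x) - K * N * integral\<^sup>L lborel (\<lambda>x. norm x / R * (W x * \<psi> x)) - K * \<rho> * integral\<^sup>L lborel ?w"
        by (rule integral_linear_combination[OF int1 int2 int3])
      ultimately have "c * integral\<^sup>L lborel (\<lambda>x. W x * \<psi> x)
        \<le> K * N * integral\<^sup>L lborel (\<lambda>x. norm x / R * (W x * \<psi> x)) + K * \<rho> * integral\<^sup>L lborel ?w"
        using T(2) by linarith
      also have "K * \<rho> * integral\<^sup>L lborel ?w \<le> (K * C) * N powr (- \<beta>)"
      proof -
        have "0 \<le> integral\<^sup>L lborel (\<lambda>x. indicator (cball 0 1) x * u x powr \<alpha>)"
          by (rule Bochner_Integration.integral_nonneg) simp
        also have "\<dots> \<le> C" using C[of 1] by simp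
        finally have C0: "C \<ge> 0" .
        have "K * \<rho> * integral\<^sup>L lborel ?w \<le> K * \<rho> * (C * R powr (n + 2))"
          using C[OF R] K by (intro mult_left_mono) (auto simp: \<rho>_def)
        also have "\<dots> = K * C * N powr (- \<beta>) * R powr (n + 2 - 1 / (1 - \<theta>))"
          using R by (simp add: \<rho>_def powr_diff powr_minus_divide)
        also have "R powr (n + 2 - 1 / (1 - \<theta>)) \<le> R powr 0"
          using R conj_ge by (intro powr_mono) auto
        finally show ?thesis
          using R K C0 by (simp add: mult_left_mono)
      qed
      finally show ?thesis unfolding \<psi>_def R_def by simp
    qed
  qed
  then show ?thesis using pos[of x] by (simp add: W_def)
qed

lemma no_positive_solution:
  assumes "p \<le> (n + 2) / (n - 2)" "coercive n p q M s c" "c > 0"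
  shows False
proof -
  have "D x = 0" for x
  proof -
    have "(G x)\<^sup>2 \<le> 0"
      using P_eq_0[OF assms, of x] zero_le_power2[of "norm (E x)"] unfolding P_def by linarith
    then show ?thesis by (simp add: G_def)
  qed
  then have u'0: "u' i = (\<lambda>_. 0)" for i
    by (simp add: D_def vec_eq_iff fun_eq_iff)
  have "u'' i i x = 0" for i x
    using pd2[of i i x] has_pd_const[of i 0 x] unfolding u'0 by (rule has_pd_unique)
  then have "u x powr p + M * norm (D x) powr q = 0" for x
    using equation[of x] by (simp add: D_def)
  then have "u 0 powr p = 0"
    using \<open>\<And>x. D x = 0\<close> by simp
  then show False using pos[of 0] by simp
qed

end

section \<open>The Liouville theorem\<close>

lemma solution_eq_0:
  fixes v :: "real ^ 'n::finite \<Rightarrow> real"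
  assumes dim: "CARD('n) \<ge> 3" and p: "1 < p" "p \<le> (real CARD('n) + 2) / (real CARD('n) - 2)"
    and q: "q = 2 * p / (p + 1)" and M: "M > 0"
    and coer: "coercive (real CARD('n)) p q M s c" "c > 0"
    and v: "nonneg_solution p q M v"
  shows "v x = 0"
proof (rule ccontr)
  assume "v x \<noteq> 0"
  have C1: "C1_on_UNIV v" "\<And>i. C1_on_UNIV (partial i v)" and v0: "\<And>x. v x \<ge> 0"
    and eq: "\<And>x. laplacian v x + v x powr p + M * norm (gradient v x) powr q = 0"
    using v by (auto simp: nonneg_solution_def C2_on_UNIV_def)
  note pd = C1_has_pd[OF C1(1)] and pd2 = C1_has_pd[OF C1(2)]
  have cont: "continuous_on UNIV (partial i (partial j v))" for i j
    by (rule C1_continuous_partial[OF C1(2)])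
  have cv: "continuous_on UNIV v"
    by (rule continuous_if_continuous_pd[OF pd C1_continuous_partial[OF C1(1)]])
  have eq': "(\<Sum>i\<in>UNIV. partial i (partial i v) x) = - (v x powr p + M * norm (\<chi> i. partial i v x) powr q)" for x
    using eq[of x] by (simp add: laplacian_def gradient_def[abs_def])
  have super: "(\<Sum>i\<in>UNIV. partial i (partial i v) x) \<le> 0" for x
  proof -
    have "v x powr p + M * norm (\<chi> i. partial i v x) powr q \<ge> 0"
      using M by (intro add_nonneg_nonneg) auto
    then show ?thesis unfolding eq' by linarith
  qed
  have "v x > 0" using \<open>v x \<noteq> 0\<close> v0[of x] by simp
  then obtain k where k: "k > 0" "\<And>y. v y \<ge> k * (1 + norm y) powr (2 - real CARD('n))"
    using superharmonic_lower_bound[OF pd pd2 cv super v0 _ dim] by blast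
  have "v y > 0" for y
  proof -
    have "1 + norm y > 0" using norm_ge_zero[of y] by linarith
    then have "k * (1 + norm y) powr (2 - real CARD('n)) > 0" using k(1) by simp
    then show ?thesis using k(2)[of y] by linarith
  qed
  then interpret positive_solution v "\<lambda>i. partial i v" "\<lambda>i j. partial i (partial j v)" "real CARD('n)" p q M
    using dim p q M pd pd2 cont eq' by unfold_locales auto
  show False
    using assms(3) coer by (rule no_positive_solution)
qed

theorem theorem1p5:
  fixes p q :: real
  assumes "CARD('n::finite) \<ge> 3"
    and "1 < p"
    and "p \<le> (real CARD('n) + 2) / (real CARD('n) - 2)"
    and "q = 2 * p / (p + 1)"
  shows "(\<exists>M\<^sub>1::ereal. 0 < M\<^sub>1 \<and>
            (\<forall>M::real. 0 < M \<and> ereal M < M\<^sub>1 \<longrightarrow>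
              (\<forall>v :: real ^ 'n \<Rightarrow> real. nonneg_solution p q M v \<longrightarrow> (\<forall>x. v x = 0)))) \<and>
         (CARD('n) \<le> 6 \<longrightarrow>
            (\<forall>M::real. 0 < M \<longrightarrow>
              (\<forall>v :: real ^ 'n \<Rightarrow> real. nonneg_solution p q M v \<longrightarrow> (\<forall>x. v x = 0))))"
proof (intro conjI impI allI)
  have "real CARD('n) \<ge> 3" using assms(1) by simp
  then obtain M1 where M1: "M1 > 0" "\<And>M. 0 < M \<Longrightarrow> M < M1 \<Longrightarrow> \<exists>c>0. coercive (real CARD('n)) p q M 0 c"
    using coercive_small_M[OF _ assms(2,3,4)] by blast
  show "\<exists>M\<^sub>1::ereal. 0 < M\<^sub>1 \<and>
            (\<forall>M::real. 0 < M \<and> ereal M < M\<^sub>1 \<longrightarrow>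
              (\<forall>v :: real ^ 'n \<Rightarrow> real. nonneg_solution p q M v \<longrightarrow> (\<forall>x. v x = 0)))"
  proof (intro exI[of _ "ereal M1"] conjI allI impI)
    show "0 < ereal M1" using M1(1) by simp
    fix M :: real and v :: "real ^ 'n \<Rightarrow> real" and x
    assume M: "0 < M \<and> ereal M < ereal M1" and v: "nonneg_solution p q M v"
    then obtain c where "c > 0" "coercive (real CARD('n)) p q M 0 c"
      using M1(2) by auto
    then show "v x = 0"
      using solution_eq_0[OF assms] M v by blast
  qed
next
  fix M :: real and v :: "real ^ 'n \<Rightarrow> real" and x
  assume low: "CARD('n) \<le> 6" and M: "0 < M" and v: "nonneg_solution p q M v"
  obtain c where "c > 0" "coercive (real CARD('n)) p q M (1 / 4) c"
    using coercive_low_dimension[OF assms(1) low assms(2,3,4) M] by blast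
  then show "v x = 0"
    using solution_eq_0[OF assms M] v by blast
qed

end
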